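(* (i) $\mathscr L_{\aleph_o}$ is upper dense in $\mathscr L$: whenever $I\in\mathscr L_{\aleph_o}$, $J\in\mathscr L$ and $I\subsetneq J$, there is $L\in\mathscr L_{\aleph_o}$ with $I\subsetneq L\subsetneq J$. (ii) $\mathscr{PL}$ is upper dense in $\mathscr L$: whenever $I\in\mathscr{PL}$, $J\in\mathscr L$ and $I\subsetneq J$, there is $L\in\mathscr{PL}$ with $I\subsetneq L\subsetneq J$. In particular, $\mathscr L_{\aleph_o}$ and $\mathscr{PL}$ have no gaps.
   Context: $H$ is a separable infinite-dimensional complex Hilbert space. "Ideal" means a two-sided ideal of $B(H)$ contained in the compact operators. $\mathscr L$ is the lattice of all nonzero ideals, ordered by inclusion (meet $\cap$, join $+$). $\mathscr{PL}\subset\mathscr L$ is the sublattice of all nonzero principal ideals (generated by one operator), and $\mathscr L_{\aleph_o}\subset\mathscr L$ is the sublattice of all nonzero countably generated ideals (generated by a countable set of operators). A gap in a lattice of ideals is a pair $I\subsetneq J$ of (nonzero) ideals in the lattice such that there is no ideal of the lattice strictly between $I$ and $J$. *)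

theory Defs
  imports "HOL-Analysis.Analysis" "HOL-Algebra.Ideal"
begin

text \<open>
  Complex Hilbert spaces. Every complex Hilbert space is a real Hilbert space under the real part
  of its inner product, so the class extends the library's complete real inner product spaces by a
  complex scalar multiplication and a complex inner product (linear in the first argument) that
  induce the given real structure. Norm, topology and completeness are those of the library.
\<close>

class complex_hilbert_space = real_inner + complete_space +
  fixes scaleC :: "complex \<Rightarrow> 'a \<Rightarrow> 'a"  (infixr \<open>*\<^sub>C\<close> 75)
    and cinner :: "'a \<Rightarrow> 'a \<Rightarrow> complex"
  assumes scaleC_add_right: "c *\<^sub>C (x + y) = c *\<^sub>C x + c *\<^sub>C y"
    and scaleC_add_left: "(c + d) *\<^sub>C x = c *\<^sub>C x + d *\<^sub>C x"
    and scaleC_scaleC: "c *\<^sub>C (d *\<^sub>C x) = (c * d) *\<^sub>C x"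
    and scaleC_of_real: "complex_of_real r *\<^sub>C x = r *\<^sub>R x"
    and cinner_commute: "cinner x y = cnj (cinner y x)"
    and cinner_add_left: "cinner (x + y) z = cinner x z + cinner y z"
    and cinner_scaleC_left: "cinner (c *\<^sub>C x) y = c * cinner x y"
    and Re_cinner: "Re (cinner x y) = inner x y"

lemma vector_space_scaleC:
  "vector_space (scaleC :: complex \<Rightarrow> 'a \<Rightarrow> 'a::complex_hilbert_space)"
proof
  fix x :: 'a
  show "1 *\<^sub>C x = x"
    using scaleC_of_real[of 1 x] by simp
qed (simp_all add: scaleC_add_right scaleC_add_left scaleC_scaleC)

lemma cinner_self:
  "cinner x x = complex_of_real ((norm x)\<^sup>2)" for x :: "'a::complex_hilbert_space"
proof (rule complex_eqI)
  show "Re (cinner x x) = Re (complex_of_real ((norm x)\<^sup>2))"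
    by (simp add: Re_cinner power2_norm_eq_inner)
  have "Im (cinner x x) = - Im (cinner x x)"
    using arg_cong[OF cinner_commute[of x x], of Im] by simp
  then show "Im (cinner x x) = Im (complex_of_real ((norm x)\<^sup>2))"
    by simp
qed

definition infinite_dimensional :: "'a::complex_hilbert_space itself \<Rightarrow> bool" where
  "infinite_dimensional _ \<longleftrightarrow>
     \<not> (\<exists>B :: 'a set. finite B \<and> module.span scaleC B = UNIV)"

text \<open>
  The ring \<open>B(H)\<close>: the library's bounded linear operators are only real-linear, so
  complex-linearity is imposed through the carrier.
\<close>

definition BH :: "('a::complex_hilbert_space \<Rightarrow>\<^sub>L 'a) ring" where
  "BH = \<lparr>carrier = {T. \<forall>c x. blinfun_apply T (c *\<^sub>C x) = c *\<^sub>C blinfun_apply T x},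
         mult = (\<lambda>S T. S o\<^sub>L T), one = id_blinfun,
         zero = 0, add = (\<lambda>S T. S + T)\<rparr>"

lemma ring_BH: "ring (BH :: ('a::complex_hilbert_space \<Rightarrow>\<^sub>L 'a) ring)"
proof (rule ringI)
  interpret H: vector_space "scaleC :: complex \<Rightarrow> 'a \<Rightarrow> 'a"
    by (rule vector_space_scaleC)
  show "abelian_group (BH :: ('a \<Rightarrow>\<^sub>L 'a) ring)"
  proof (rule abelian_groupI)
    fix S :: "'a \<Rightarrow>\<^sub>L 'a"
    assume "S \<in> carrier BH"
    then show "\<exists>T\<in>carrier BH. T \<oplus>\<^bsub>BH\<^esub> S = \<zero>\<^bsub>BH\<^esub>"
      by (intro bexI[of _ "- S"]) (simp_all add: BH_def blinfun.minus_left H.scale_minus_right)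
  qed (auto simp: BH_def blinfun.add_left scaleC_add_right)
  show "monoid (BH :: ('a \<Rightarrow>\<^sub>L 'a) ring)"
    by (rule monoidI) (auto simp: BH_def intro!: blinfun_eqI)
qed (auto simp: BH_def blinfun.add_left blinfun.add_right intro!: blinfun_eqI)

definition compact_operators :: "('a::complex_hilbert_space \<Rightarrow>\<^sub>L 'a) set" where
  "compact_operators =
     {T \<in> carrier BH. compact (closure (blinfun_apply T ` cball 0 1))}"

text \<open>
  The lattices of nonzero ideals, all ordered by inclusion. Ring ideals of \<open>B(H)\<close> are
  automatically closed under complex scalars, because the ring contains the scalar operators.
  Generators need not be required to be compact: they lie in the ideal they generate.
\<close>

definition nonzero_ideals :: "('a::complex_hilbert_space \<Rightarrow>\<^sub>L 'a) set set" where
  "nonzero_ideals = {I. ideal I BH \<and> I \<subseteq> compact_operators \<and> I \<noteq> {\<zero>\<^bsub>BH\<^esub>}}"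

definition principal_nonzero_ideals :: "('a::complex_hilbert_space \<Rightarrow>\<^sub>L 'a) set set" where
  "principal_nonzero_ideals = {I \<in> nonzero_ideals. principalideal I BH}"

definition countably_generated_nonzero_ideals ::
    "('a::complex_hilbert_space \<Rightarrow>\<^sub>L 'a) set set" where
  "countably_generated_nonzero_ideals =
     {I \<in> nonzero_ideals. \<exists>S. countable S \<and> S \<subseteq> carrier BH \<and> I = Idl\<^bsub>BH\<^esub> S}"

definition upper_dense_in :: "'b set set \<Rightarrow> 'b set set \<Rightarrow> bool" where
  "upper_dense_in M N \<longleftrightarrow> (\<forall>I\<in>M. \<forall>J\<in>N. I \<subset> J \<longrightarrow> (\<exists>L\<in>M. I \<subset> L \<and> L \<subset> J))"

definition is_gap :: "'b set set \<Rightarrow> 'b set \<Rightarrow> 'b set \<Rightarrow> bool" where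
  "is_gap M I J \<longleftrightarrow> I \<in> M \<and> J \<in> M \<and> I \<subset> J \<and> \<not> (\<exists>L\<in>M. I \<subset> L \<and> L \<subset> J)"

end

theory Submission
  imports Defs "HOL-Complex_Analysis.Great_Picard"
begin

text \<open>
  Let \<open>I\<close> be generated by a countable set \<open>S\<close> and let \<open>T \<in> J\<close> with \<open>T \<notin> I\<close>. Fix an orthonormal basis and
  consider the operators \<open>X = P\<^sub>M T\<close>, where \<open>P\<^sub>M\<close> projects onto the closed span of the basis vectors with
  index in \<open>M\<close>. They form a norm closed set, and it suffices to find one with \<open>X \<notin> I\<close> and
  \<open>T \<notin> Idl (insert X S)\<close>: then \<open>Idl (insert X S)\<close> lies strictly between \<open>I\<close> and \<open>J\<close>.

  Such an \<open>X\<close> is obtained from the Baire category theorem. The ideal generated by a set of compact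
  operators is the union of the sets of sums of \<open>A R B\<close>, over a finite list of generators \<open>R\<close> and with
  a bound on the norms of \<open>A\<close> and \<open>B\<close>. By weak compactness of balls of operators, these sets are norm closed,
  also when the generators vary continuously; so both conditions on \<open>X\<close> are countable intersections
  of open conditions. Each is dense because \<open>P\<^sub>n T\<close> converges to \<open>T\<close> in norm: changing \<open>M\<close> far out so that it
  contains all large indices makes \<open>X \<notin> I\<close>, and making it finite gives \<open>X\<close> of finite rank, so that
  \<open>Idl (insert X S) = I\<close>.

  For principal ideals, two generators are replaced by their direct sum, since the space is
  isomorphic to its own square.
\<close>

section \<open>Complex inner products\<close>

instance complex_hilbert_space \<subseteq> banach ..

interpretation scaleC: vector_space "scaleC :: complex \<Rightarrow> 'a \<Rightarrow> 'a::complex_hilbert_space"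
  by (rule vector_space_scaleC)

lemma cinner_zero_left [simp]: "cinner 0 y = 0"
  using cinner_add_left[of 0 0 y] by simp

lemma cinner_zero_right [simp]: "cinner x 0 = 0"
  by (subst cinner_commute) simp

lemma cinner_add_right: "cinner x (y + z) = cinner x y + cinner x z"
  by (metis cinner_add_left cinner_commute complex_cnj_add)

lemma cinner_scaleC_right: "cinner x (c *\<^sub>C y) = cnj c * cinner x y"
  by (metis cinner_scaleC_left cinner_commute complex_cnj_mult)

lemma cinner_minus_left [simp]: "cinner (- x) y = - cinner x y"
  using cinner_add_left[of x "- x" y] by (simp add: eq_neg_iff_add_eq_0 add.commute)

lemma cinner_diff_left: "cinner (x - y) z = cinner x z - cinner y z"
  using cinner_add_left[of x "- y" z] by simp

lemma cinner_sum_left: "cinner (\<Sum>i\<in>A. f i) y = (\<Sum>i\<in>A. cinner (f i) y)"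
  by (induction A rule: infinite_finite_induct) (auto simp: cinner_add_left)

lemma cinner_sum_right: "cinner y (\<Sum>i\<in>A. f i) = (\<Sum>i\<in>A. cinner y (f i))"
  by (induction A rule: infinite_finite_induct) (auto simp: cinner_add_right)

lemma norm_scaleC [simp]: "norm (c *\<^sub>C x) = cmod c * norm x"
proof -
  have "complex_of_real ((norm (c *\<^sub>C x))\<^sup>2) = cinner (c *\<^sub>C x) (c *\<^sub>C x)"
    by (rule cinner_self[symmetric])
  also have "\<dots> = (c * cnj c) * cinner x x"
    by (simp add: cinner_scaleC_left cinner_scaleC_right)
  also have "\<dots> = complex_of_real ((cmod c * norm x)\<^sup>2)"
    by (simp only: cinner_self complex_norm_square[symmetric] of_real_mult[symmetric] power_mult_distrib)
  finally have "(norm (c *\<^sub>C x))\<^sup>2 = (cmod c * norm x)\<^sup>2"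
    using of_real_eq_iff by blast
  then show ?thesis
    by (simp add: power2_eq_iff_nonneg)
qed

lemma norm_cinner_le: "cmod (cinner x y) \<le> norm x * norm y"
proof (cases "cinner x y = 0")
  case False
  \<comment> \<open>The phase \<open>c\<close> rotates \<open>cinner x y\<close> onto the
    nonnegative real axis, where the real Cauchy-Schwarz inequality applies.\<close>
  define c where "c = cnj (sgn (cinner x y))"
  have c: "cmod c = 1"
    using False by (simp add: c_def norm_sgn)
  have "c * cinner x y = complex_of_real (cmod (cinner x y))"
    using False complex_norm_square[of "cinner x y"]
    by (simp add: c_def sgn_eq power2_eq_square nonzero_divide_eq_eq mult.commute)
  then have "cmod (cinner x y) = Re (cinner (c *\<^sub>C x) y)"
    by (simp add: cinner_scaleC_left)
  also have "\<dots> = inner (c *\<^sub>C x) y"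
    by (rule Re_cinner)
  also have "\<dots> \<le> norm (c *\<^sub>C x) * norm y"
    by (rule norm_cauchy_schwarz)
  finally show ?thesis
    by (simp add: c)
qed simp

lemma bounded_linear_cinner_left: "bounded_linear (\<lambda>x. cinner x y)"
  by (rule bounded_linear_intro[where K = "norm y"])
    (auto simp: cinner_add_left scaleC_of_real[symmetric] cinner_scaleC_left scaleR_conv_of_real
       norm_cinner_le)

lemmas tendsto_cinner_left = bounded_linear.tendsto[OF bounded_linear_cinner_left]

text \<open>Serves weak convergence: pairings are approximated by truncating a vector or a compact
  operator to finitely many coordinates. Closeness is asked only eventually because in
  \<open>wot_tendsto_sandwich\<close> the middle factor is near its limit only for large
  \<open>n\<close>.\<close>

lemma tendsto_of_uniform_approx:
  fixes u :: "nat \<Rightarrow> 'b::real_normed_vector"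
  assumes "\<And>\<epsilon>. \<epsilon> > 0 \<Longrightarrow> \<exists>v m. v \<longlonglongrightarrow> m \<and> (\<forall>\<^sub>F n in sequentially. norm (u n - v n) \<le> \<epsilon>) \<and> norm (l - m) \<le> \<epsilon>"
  shows "u \<longlonglongrightarrow> l"
proof (rule tendstoI)
  fix \<epsilon> :: real assume "\<epsilon> > 0"
  then obtain v m where v: "v \<longlonglongrightarrow> m" "\<forall>\<^sub>F n in sequentially. norm (u n - v n) \<le> \<epsilon>/4" "norm (l - m) \<le> \<epsilon>/4"
    using assms[of "\<epsilon>/4"] by (metis zero_less_divide_iff zero_less_numeral)
  have "\<forall>\<^sub>F n in sequentially. dist (v n) m < \<epsilon>/4"
    using v(1) \<open>\<epsilon> > 0\<close> by (intro tendstoD) auto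
  with v(2) show "\<forall>\<^sub>F n in sequentially. dist (u n) l < \<epsilon>"
  proof eventually_elim
    case (elim n)
    have "dist (u n) l \<le> dist (u n) (v n) + dist (v n) m + dist l m"
      using dist_triangle[of "u n" l m] dist_triangle[of "u n" m "v n"] by (simp add: dist_commute)
    with elim v(3) \<open>\<epsilon> > 0\<close> show ?case
      by (simp add: dist_norm)
  qed
qed

text \<open>Counterpart for a limit not known in advance: the Cauchy property is inherited from the
  approximations, and completeness supplies the limit.\<close>

lemma convergent_of_uniform_approx:
  fixes u :: "nat \<Rightarrow> 'b::banach"
  assumes "\<And>\<epsilon>. \<epsilon> > 0 \<Longrightarrow> \<exists>v. convergent v \<and> (\<forall>n. norm (u n - v n) \<le> \<epsilon>)"
  shows "convergent u"
proof -
  have "Cauchy u"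
  proof (rule metric_CauchyI)
    fix \<epsilon> :: real assume "\<epsilon> > 0"
    then obtain v where v: "convergent v" "\<And>n. norm (u n - v n) \<le> \<epsilon>/4"
      using assms[of "\<epsilon>/4"] by (metis zero_less_divide_iff zero_less_numeral)
    then obtain M where M: "\<And>m n. m \<ge> M \<Longrightarrow> n \<ge> M \<Longrightarrow> dist (v m) (v n) < \<epsilon>/4"
      using metric_CauchyD[OF convergent_Cauchy, of v "\<epsilon>/4"] \<open>\<epsilon> > 0\<close> by fastforce
    have "dist (u m) (u n) < \<epsilon>" if "m \<ge> M" "n \<ge> M" for m n
    proof -
      have "dist (u m) (u n) \<le> dist (u m) (v m) + dist (v m) (v n) + dist (u n) (v n)"
        using dist_triangle[of "u m" "u n" "v n"] dist_triangle[of "u m" "v n" "v m"]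
        by (simp add: dist_commute)
      with v(2)[of m] v(2)[of n] M[OF that] \<open>\<epsilon> > 0\<close> show ?thesis
        by (simp add: dist_norm)
    qed
    then show "\<exists>M. \<forall>m\<ge>M. \<forall>n\<ge>M. dist (u m) (u n) < \<epsilon>" by blast
  qed
  then show ?thesis
    by (simp add: Cauchy_convergent_iff)
qed

section \<open>Orthonormal bases\<close>

text \<open>Totality is stated as triviality of the orthogonal complement, the form that maximality
  of an orthonormal set delivers; convergence of the expansion follows in
  \<open>expansion\<close>.\<close>

locale orthonormal_basis =
  fixes e :: "nat \<Rightarrow> 'a::complex_hilbert_space"
  assumes cinner_basis: "cinner (e i) (e j) = (if i = j then 1 else 0)"
    and total: "(\<And>j. cinner x (e j) = 0) \<Longrightarrow> x = 0"
begin

lemma eqI: "(\<And>j. cinner x (e j) = cinner y (e j)) \<Longrightarrow> x = y"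
  using total[of "x - y"] by (simp add: cinner_diff_left)

lemma norm_basis [simp]: "norm (e j) = 1"
proof -
  have "complex_of_real ((norm (e j))\<^sup>2) = complex_of_real 1"
    using cinner_self[of "e j"] by (simp add: cinner_basis del: of_real_power)
  then have "(norm (e j))\<^sup>2 = 1"
    using of_real_eq_iff by blast
  then show ?thesis
    by (simp add: power2_eq_1_iff) (smt (verit) norm_ge_zero)
qed

lemma cinner_combination:
  "finite A \<Longrightarrow> cinner (\<Sum>i\<in>A. c i *\<^sub>C e i) (e j) = (if j \<in> A then c j else 0)"
  by (simp add: cinner_sum_left cinner_scaleC_left cinner_basis if_distrib cong: if_cong)

lemma norm_combination:
  assumes "finite A"
  shows "(norm (\<Sum>i\<in>A. c i *\<^sub>C e i))\<^sup>2 = (\<Sum>i\<in>A. (cmod (c i))\<^sup>2)"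
proof -
  have "complex_of_real ((norm (\<Sum>i\<in>A. c i *\<^sub>C e i))\<^sup>2) =
      cinner (\<Sum>i\<in>A. c i *\<^sub>C e i) (\<Sum>i\<in>A. c i *\<^sub>C e i)"
    by (rule cinner_self[symmetric])
  also have "\<dots> = (\<Sum>j\<in>A. cnj (c j) * c j)"
    by (subst cinner_sum_right, simp add: cinner_scaleC_right cinner_combination[OF assms])
  also have "\<dots> = complex_of_real (\<Sum>i\<in>A. (cmod (c i))\<^sup>2)"
    by (simp add: complex_norm_square mult.commute del: of_real_power)
  finally show ?thesis
    using of_real_eq_iff by blast
qed

text \<open>Pairing \<open>x\<close> with its partial expansion \<open>y\<close> gives the squared
  norm of \<open>y\<close>, so Cauchy-Schwarz bounds the norm of \<open>y\<close> by that of
  \<open>x\<close>.\<close>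

lemma bessel: "finite A \<Longrightarrow> (\<Sum>j\<in>A. (cmod (cinner x (e j)))\<^sup>2) \<le> (norm x)\<^sup>2"
proof -
  assume A: "finite A"
  define y where "y = (\<Sum>i\<in>A. cinner x (e i) *\<^sub>C e i)"
  have ny: "(norm y)\<^sup>2 = (\<Sum>j\<in>A. (cmod (cinner x (e j)))\<^sup>2)"
    unfolding y_def by (rule norm_combination[OF A])
  have "cinner x y = complex_of_real ((norm y)\<^sup>2)"
    unfolding ny by (simp add: y_def cinner_sum_right cinner_scaleC_right complex_norm_square mult.commute del: of_real_power)
  then have "inner x y = (norm y)\<^sup>2"
    by (metis Re_cinner Re_complex_of_real)
  moreover have "inner x y \<le> norm x * norm y"
    by (rule norm_cauchy_schwarz)
  ultimately have "norm y \<le> norm x"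
    by (cases "norm y = 0") (auto simp: power2_eq_square)
  then show ?thesis
    by (simp flip: ny)
qed

text \<open>By orthogonality the squared distance of two partial sums is a difference of partial
  sums of a convergent numerical series, so the vectors form a Cauchy sequence.\<close>

lemma riesz_fischer:
  assumes "\<And>N. (\<Sum>j<N. (cmod (c j))\<^sup>2) \<le> K\<^sup>2" "K \<ge> 0"
  obtains y where "\<And>j. cinner y (e j) = c j" "norm y \<le> K" "(\<lambda>N. \<Sum>j<N. c j *\<^sub>C e j) \<longlonglongrightarrow> y"
proof -
  define s where "s = (\<lambda>N. \<Sum>j<N. c j *\<^sub>C e j)"
  have sq: "(norm (s N))\<^sup>2 = (\<Sum>j<N. (cmod (c j))\<^sup>2)" for N
    unfolding s_def by (rule norm_combination) simp
  have diff: "(norm (s M - s N))\<^sup>2 = (\<Sum>j<M. (cmod (c j))\<^sup>2) - (\<Sum>j<N. (cmod (c j))\<^sup>2)" if "N \<le> M" for M N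
  proof -
    have "s M - s N = (\<Sum>j\<in>{N..<M}. c j *\<^sub>C e j)"
      unfolding s_def using that by (simp add: lessThan_atLeast0 sum_diff_nat_ivl)
    then show ?thesis
      using that by (simp add: norm_combination lessThan_atLeast0 sum_diff_nat_ivl)
  qed
  have "Cauchy s"
  proof (rule metric_CauchyI)
    fix \<epsilon> :: real assume "\<epsilon> > 0"
    have "summable (\<lambda>j. (cmod (c j))\<^sup>2)"
      using assms(1) by (intro summableI_nonneg_bounded[where x = "K\<^sup>2"]) auto
    then have "Cauchy (\<lambda>N. \<Sum>j<N. (cmod (c j))\<^sup>2)"
      by (simp add: summable_iff_convergent Cauchy_convergent_iff)
    then obtain M where M: "\<And>m n. m \<ge> M \<Longrightarrow> n \<ge> M \<Longrightarrow>
        dist (\<Sum>j<m. (cmod (c j))\<^sup>2) (\<Sum>j<n. (cmod (c j))\<^sup>2) < \<epsilon>\<^sup>2"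
      using metric_CauchyD[of _ "\<epsilon>\<^sup>2"] \<open>\<epsilon> > 0\<close> by (metis zero_less_power)
    have *: "norm (s m - s n) < \<epsilon>" if "m \<ge> n" "n \<ge> M" for m n
    proof -
      have "(norm (s m - s n))\<^sup>2 < \<epsilon>\<^sup>2"
        using M[of m n] that by (simp add: diff dist_real_def)
      then show ?thesis
        using \<open>\<epsilon> > 0\<close> power2_less_imp_less by fastforce
    qed
    have "dist (s m) (s n) < \<epsilon>" if "m \<ge> M" "n \<ge> M" for m n
      using *[of n m] *[of m n] that by (cases "n \<le> m") (auto simp: dist_norm norm_minus_commute)
    then show "\<exists>M. \<forall>m\<ge>M. \<forall>n\<ge>M. dist (s m) (s n) < \<epsilon>" by blast
  qed
  then obtain y where y: "s \<longlonglongrightarrow> y"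
    using Cauchy_convergent_iff convergent_def by blast
  have "cinner y (e j) = c j" for j
  proof (rule LIMSEQ_unique)
    show "(\<lambda>N. cinner (s N) (e j)) \<longlonglongrightarrow> cinner y (e j)"
      by (rule tendsto_cinner_left[OF y])
    have "\<forall>\<^sub>F N in sequentially. cinner (s N) (e j) = c j"
      using eventually_gt_at_top[of j]
      by eventually_elim (simp add: s_def cinner_combination)
    then show "(\<lambda>N. cinner (s N) (e j)) \<longlonglongrightarrow> c j"
      by (rule tendsto_eventually)
  qed
  moreover have "norm y \<le> K"
  proof (rule LIMSEQ_le_const2[OF tendsto_norm[OF y]])
    show "\<exists>N. \<forall>n\<ge>N. norm (s n) \<le> K"
      using assms by (metis power2_le_imp_le sq)
  qed
  ultimately show thesis
    using y that unfolding s_def by blast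
qed

lemma expansion: "(\<lambda>N. \<Sum>j<N. cinner x (e j) *\<^sub>C e j) \<longlonglongrightarrow> x"
proof -
  obtain y where "\<And>j. cinner y (e j) = cinner x (e j)"
      "(\<lambda>N. \<Sum>j<N. cinner x (e j) *\<^sub>C e j) \<longlonglongrightarrow> y"
    by (rule riesz_fischer[of "\<lambda>j. cinner x (e j)" "norm x"]) (auto simp: bessel)
  then show ?thesis
    using eqI[of y x] by simp
qed

lemma norm_leI:
  assumes "\<And>N. (\<Sum>j<N. (cmod (cinner x (e j)))\<^sup>2) \<le> K\<^sup>2" "K \<ge> 0"
  shows "norm x \<le> K"
  using riesz_fischer[OF assms] eqI by metis

lemma norm_mono:
  assumes "\<And>j. cmod (cinner x (e j)) \<le> cmod (cinner y (e j))"
  shows "norm x \<le> norm y"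
proof (rule norm_leI)
  fix N
  have "(\<Sum>j<N. (cmod (cinner x (e j)))\<^sup>2) \<le> (\<Sum>j<N. (cmod (cinner y (e j)))\<^sup>2)"
    using assms by (intro sum_mono power_mono) auto
  also have "\<dots> \<le> (norm y)\<^sup>2"
    by (rule bessel) simp
  finally show "(\<Sum>j<N. (cmod (cinner x (e j)))\<^sup>2) \<le> (norm y)\<^sup>2" .
qed simp

text \<open>The common source of adjoints, weak limits and coordinate operators. The bound on square
  sums lets Riesz-Fischer build each value; linearity is checked coordinatewise, since coordinates
  determine a vector.\<close>

lemma operator_of_coordinates:
  assumes add: "\<And>j x y. f j (x + y) = f j x + f j y"
    and scale: "\<And>j c x. f j (c *\<^sub>C x) = c * f j x"
    and bound: "\<And>x N. (\<Sum>j<N. (cmod (f j x))\<^sup>2) \<le> (C * norm x)\<^sup>2" and "C \<ge> 0"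
  obtains U :: "'a \<Rightarrow>\<^sub>L 'a" where "U \<in> carrier BH" "norm U \<le> C"
    "\<And>x j. cinner (blinfun_apply U x) (e j) = f j x"
proof -
  have "\<exists>y. (\<forall>j. cinner y (e j) = f j x) \<and> norm y \<le> C * norm x" for x
    by (rule riesz_fischer[OF bound, of x]) (use \<open>C \<ge> 0\<close> in auto)
  then obtain u where u: "\<And>x j. cinner (u x) (e j) = f j x" "\<And>x. norm (u x) \<le> C * norm x"
    by metis
  have u_scale: "u (c *\<^sub>C x) = c *\<^sub>C u x" for c x
    by (rule eqI) (simp add: u scale cinner_scaleC_left)
  have lin: "bounded_linear u"
  proof (rule bounded_linear_intro)
    show "u (x + y) = u x + u y" for x y
      by (rule eqI) (simp add: u add cinner_add_left)
    show "u (r *\<^sub>R x) = r *\<^sub>R u x" for r x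
      using u_scale[of "complex_of_real r" x] by (simp add: scaleC_of_real)
    show "norm (u x) \<le> norm x * C" for x
      using u(2)[of x] by (simp add: mult.commute)
  qed
  show thesis
  proof
    show "Blinfun u \<in> carrier BH"
      by (simp add: BH_def bounded_linear_Blinfun_apply[OF lin] u_scale)
    show "norm (Blinfun u) \<le> C"
      by (rule norm_blinfun_bound) (simp_all add: bounded_linear_Blinfun_apply[OF lin] u \<open>C \<ge> 0\<close>)
    show "cinner (blinfun_apply (Blinfun u) x) (e j) = f j x" for x j
      by (simp add: bounded_linear_Blinfun_apply[OF lin] u)
  qed
qed

end

section \<open>Weak operator topology\<close>

lemma carrier_BH: "T \<in> carrier BH \<longleftrightarrow> (\<forall>c x. blinfun_apply T (c *\<^sub>C x) = c *\<^sub>C blinfun_apply T x)"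
  by (simp add: BH_def)

lemma carrier_BH_intros [simp, intro]:
  "S \<in> carrier BH \<Longrightarrow> T \<in> carrier BH \<Longrightarrow> S o\<^sub>L T \<in> carrier BH"
  "S \<in> carrier BH \<Longrightarrow> T \<in> carrier BH \<Longrightarrow> S + T \<in> carrier BH"
  "S \<in> carrier BH \<Longrightarrow> T \<in> carrier BH \<Longrightarrow> S - T \<in> carrier BH"
  "S \<in> carrier BH \<Longrightarrow> - S \<in> carrier BH"
  "0 \<in> carrier BH" "id_blinfun \<in> carrier BH"
  by (simp_all add: carrier_BH blinfun.add_left blinfun.diff_left blinfun.minus_left scaleC_add_right
      scaleC.scale_right_diff_distrib)

lemma apply_combination:
  "T \<in> carrier BH \<Longrightarrow> blinfun_apply T (\<Sum>i\<in>A. c i *\<^sub>C f i) = (\<Sum>i\<in>A. c i *\<^sub>C blinfun_apply T (f i))"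
  by (simp add: blinfun.sum_right carrier_BH)

text \<open>Convergence in the weak operator topology, for sequences only: bounded sequences have
  convergent subsequences by \<open>weak_operator_compactness\<close>, so nets do not arise.\<close>

definition wot_tendsto :: "(nat \<Rightarrow> 'a::complex_hilbert_space \<Rightarrow>\<^sub>L 'a) \<Rightarrow> ('a \<Rightarrow>\<^sub>L 'a) \<Rightarrow> bool" where
  "wot_tendsto Z L \<longleftrightarrow> (\<forall>x y. (\<lambda>n. cinner (Z n x) y) \<longlonglongrightarrow> cinner (L x) y)"

lemma wot_tendsto_subseq: "wot_tendsto Z L \<Longrightarrow> strict_mono s \<Longrightarrow> wot_tendsto (Z \<circ> s) L"
  unfolding wot_tendsto_def using LIMSEQ_subseq_LIMSEQ by (fastforce simp: o_def)

lemma wot_tendsto_add: "wot_tendsto Y K \<Longrightarrow> wot_tendsto Z L \<Longrightarrow> wot_tendsto (\<lambda>n. Y n + Z n) (K + L)"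
  by (simp add: wot_tendsto_def blinfun.add_left cinner_add_left tendsto_add)

lemma tendsto_imp_wot_tendsto:
  assumes "Z \<longlonglongrightarrow> L" shows "wot_tendsto Z L"
  unfolding wot_tendsto_def
  by (intro allI tendsto_cinner_left blinfun.tendsto assms tendsto_const)

lemma cmod_cinner_apply_le: "cmod (cinner (blinfun_apply T x) y) \<le> norm T * norm x * norm y"
  by (meson mult_right_mono norm_blinfun norm_cinner_le norm_ge_zero order_trans)

section \<open>Adjoints, weak compactness of balls, and coordinate operators\<close>

context orthonormal_basis
begin

lemma wot_limit_unique:
  fixes K L :: "'a \<Rightarrow>\<^sub>L 'a"
  assumes "wot_tendsto Z K" "wot_tendsto Z L" shows "K = L"
proof (rule blinfun_eqI, rule eqI)
  show "cinner (blinfun_apply K x) (e j) = cinner (blinfun_apply L x) (e j)" for x j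
    using assms LIMSEQ_unique unfolding wot_tendsto_def by blast
qed

text \<open>The coordinates of \<open>B y\<close> are forced to be
  \<open>cinner y (A (e j))\<close>. They are square summable: with \<open>w\<close> their partial
  combination, the squared norm of \<open>w\<close> equals \<open>cinner y (A w)\<close>, which
  bounds the norm of \<open>w\<close>. The identity then passes from basis vectors to all
  \<open>x\<close> by linearity and continuity.\<close>

lemma adjoint_exists:
  fixes A :: "'a \<Rightarrow>\<^sub>L 'a"
  assumes A: "A \<in> carrier BH"
  obtains B :: "'a \<Rightarrow>\<^sub>L 'a" where "B \<in> carrier BH" "\<And>x y. cinner (blinfun_apply A x) y = cinner x (blinfun_apply B y)"
proof -
  obtain B :: "'a \<Rightarrow>\<^sub>L 'a" where B: "B \<in> carrier BH"
    "\<And>y j. cinner (blinfun_apply B y) (e j) = cinner y (blinfun_apply A (e j))"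
  proof (rule operator_of_coordinates[of "\<lambda>j y. cinner y (blinfun_apply A (e j))" "norm A"])
    fix y N
    define c where "c = (\<lambda>j. cinner y (blinfun_apply A (e j)))"
    define w where "w = (\<Sum>j<N. c j *\<^sub>C e j)"
    have w: "(norm w)\<^sup>2 = (\<Sum>j<N. (cmod (c j))\<^sup>2)"
      unfolding w_def by (rule norm_combination) simp
    have "cinner y (blinfun_apply A w) = (\<Sum>j<N. cnj (c j) * c j)"
      by (simp add: w_def apply_combination[OF A] cinner_sum_right cinner_scaleC_right c_def)
    also have "\<dots> = complex_of_real ((norm w)\<^sup>2)"
      by (simp add: w complex_norm_square mult.commute del: of_real_power)
    finally have "(norm w)\<^sup>2 = cmod (cinner y (blinfun_apply A w))"
      by (metis abs_of_nonneg norm_of_real zero_le_power2)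
    also have "\<dots> \<le> norm y * (norm A * norm w)"
      by (meson mult_left_mono norm_blinfun norm_cinner_le norm_ge_zero order_trans)
    finally have "norm w \<le> norm A * norm y"
      by (cases "norm w = 0") (auto simp: power2_eq_square mult_ac)
    then show "(\<Sum>j<N. (cmod (cinner y (blinfun_apply A (e j))))\<^sup>2) \<le> (norm A * norm y)\<^sup>2"
      using w power_mono[of "norm w" "norm A * norm y" 2] by (simp add: c_def)
  qed (auto simp: cinner_add_left cinner_scaleC_left)
  have "cinner (blinfun_apply A x) y = cinner x (blinfun_apply B y)" for x y
  proof (rule LIMSEQ_unique)
    let ?s = "\<lambda>N. \<Sum>j<N. cinner x (e j) *\<^sub>C e j"
    show "(\<lambda>N. cinner (blinfun_apply A (?s N)) y) \<longlonglongrightarrow> cinner (blinfun_apply A x) y"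
      by (intro tendsto_cinner_left blinfun.tendsto tendsto_const expansion)
    have "cinner (blinfun_apply A (e j)) y = cinner (e j) (blinfun_apply B y)" for j
      by (metis B(2) cinner_commute)
    then have "cinner (blinfun_apply A (?s N)) y = cinner (?s N) (blinfun_apply B y)" for N
      by (simp add: apply_combination[OF A] cinner_sum_left cinner_scaleC_left)
    then show "(\<lambda>N. cinner (blinfun_apply A (?s N)) y) \<longlonglongrightarrow> cinner x (blinfun_apply B y)"
      using tendsto_cinner_left[OF expansion] by simp
  qed
  with B(1) that show thesis by blast
qed

text \<open>A diagonal subsequence makes all of the countably many matrix entries converge. The
  uniform norm bound extends this first from basis vectors to all \<open>x\<close>, then to all
  \<open>y\<close>; in between, the limits against basis vectors define \<open>L\<close>.\<close>

lemma weak_operator_compactness: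
  fixes A :: "nat \<Rightarrow> 'a \<Rightarrow>\<^sub>L 'a"
  assumes A: "\<And>n. A n \<in> carrier BH" "\<And>n. norm (A n) \<le> C"
  obtains s L where "strict_mono s" "L \<in> carrier BH" "norm L \<le> C" "wot_tendsto (A \<circ> s) L"
proof -
  have C: "C \<ge> 0"
    using A(2)[of 0] norm_ge_zero order_trans by blast
  have bnd: "cmod (cinner (blinfun_apply (A n) x) y) \<le> C * norm x * norm y" for n x y
    by (meson A(2) cmod_cinner_apply_le mult_right_mono norm_ge_zero order_trans)
  obtain s where s: "strict_mono (s :: nat \<Rightarrow> nat)"
    "\<And>p. p \<in> UNIV \<Longrightarrow> \<exists>l. (\<lambda>n. (\<lambda>(i,j). cinner (blinfun_apply (A (s n)) (e i)) (e j)) p) \<longlonglongrightarrow> l"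
    by (rule function_convergent_subsequence[of "UNIV :: (nat \<times> nat) set"
          "\<lambda>n (i,j). cinner (blinfun_apply (A n) (e i)) (e j)" C])
       (use bnd[of _ "e _" "e _"] in auto)
  have conv: "convergent (\<lambda>n. cinner (blinfun_apply (A (s n)) x) (e j))" for x j
  proof (rule convergent_of_uniform_approx)
    fix \<epsilon> :: real assume "\<epsilon> > 0"
    define t where "t = (\<lambda>m. \<Sum>i<m. cinner x (e i) *\<^sub>C e i)"
    \<comment> \<open>The summand 1 keeps the tolerance positive and the estimate valid also when
      \<open>C\<close> is 0.\<close>
    have "\<epsilon> / (C + 1) > 0"
      using C \<open>\<epsilon> > 0\<close> by simp
    then obtain m where m: "norm (t m - x) < \<epsilon> / (C + 1)"
      using LIMSEQ_D[OF expansion[of x]] unfolding t_def by blast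
    have "C * norm (x - t m) \<le> \<epsilon>"
    proof -
      have "C * norm (x - t m) \<le> C * (\<epsilon> / (C + 1))"
        using m C by (intro mult_left_mono) (auto simp: norm_minus_commute)
      also have "\<dots> \<le> \<epsilon>"
        using C \<open>\<epsilon> > 0\<close> by (simp add: field_simps)
      finally show ?thesis .
    qed
    then have "cmod (cinner (blinfun_apply (A (s n)) x) (e j) - cinner (blinfun_apply (A (s n)) (t m)) (e j)) \<le> \<epsilon>" for n
      using bnd[of "s n" "x - t m" "e j"] by (simp add: blinfun.diff_right cinner_diff_left)
    moreover have "convergent (\<lambda>n. cinner (blinfun_apply (A (s n)) (t m)) (e j))"
    proof -
      obtain l where "\<And>i. (\<lambda>n. cinner (blinfun_apply (A (s n)) (e i)) (e j)) \<longlonglongrightarrow> l i"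
        using s(2)[of "(_, j)"] by simp metis
      then have "(\<lambda>n. \<Sum>i<m. cinner x (e i) * cinner (blinfun_apply (A (s n)) (e i)) (e j)) \<longlonglongrightarrow>
          (\<Sum>i<m. cinner x (e i) * l i)"
        by (intro tendsto_sum tendsto_mult_left)
      then show ?thesis
        by (simp add: t_def apply_combination[OF A(1)] cinner_sum_left cinner_scaleC_left convergentI)
    qed
    ultimately show "\<exists>v. convergent v \<and> (\<forall>n. cmod (cinner (blinfun_apply (A (s n)) x) (e j) - v n) \<le> \<epsilon>)"
      by blast
  qed
  define f where "f = (\<lambda>j x. lim (\<lambda>n. cinner (blinfun_apply (A (s n)) x) (e j)))"
  have f: "(\<lambda>n. cinner (blinfun_apply (A (s n)) x) (e j)) \<longlonglongrightarrow> f j x" for j x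
    using conv by (simp add: f_def convergent_LIMSEQ_iff)
  obtain L :: "'a \<Rightarrow>\<^sub>L 'a" where L: "L \<in> carrier BH" "norm L \<le> C"
    "\<And>x j. cinner (blinfun_apply L x) (e j) = f j x"
  proof (rule operator_of_coordinates[of f C])
    show "f j (x + y) = f j x + f j y" for j x y
      by (rule LIMSEQ_unique[OF f])
        (use tendsto_add[OF f f, of x j y j] in \<open>simp add: blinfun.add_right cinner_add_left\<close>)
    show "f j (c *\<^sub>C x) = c * f j x" for j c x
      by (rule LIMSEQ_unique[OF f])
        (use tendsto_mult_left[OF f, of c x j] A(1) in \<open>simp add: carrier_BH cinner_scaleC_left\<close>)
    show "(\<Sum>j<N. (cmod (f j x))\<^sup>2) \<le> (C * norm x)\<^sup>2" for x N
    proof (rule LIMSEQ_le_const2)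
      show "(\<lambda>n. \<Sum>j<N. (cmod (cinner (blinfun_apply (A (s n)) x) (e j)))\<^sup>2) \<longlonglongrightarrow> (\<Sum>j<N. (cmod (f j x))\<^sup>2)"
        by (intro tendsto_sum tendsto_power tendsto_norm f)
      have "(\<Sum>j<N. (cmod (cinner (blinfun_apply (A (s n)) x) (e j)))\<^sup>2) \<le> (C * norm x)\<^sup>2" for n
      proof -
        have "norm (blinfun_apply (A (s n)) x) \<le> C * norm x"
          by (meson A(2) mult_right_mono norm_blinfun norm_ge_zero order_trans)
        then show ?thesis
          by (intro order_trans[OF bessel] power_mono) auto
      qed
      then show "\<exists>M. \<forall>n\<ge>M. (\<Sum>j<N. (cmod (cinner (blinfun_apply (A (s n)) x) (e j)))\<^sup>2) \<le> (C * norm x)\<^sup>2"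
        by blast
    qed
  qed (use C in auto)
  \<comment> \<open>So far the second argument was a basis vector; truncating the expansion of
    \<open>y\<close> passes to arbitrary \<open>y\<close>.\<close>
  have "(\<lambda>n. cinner (blinfun_apply (A (s n)) x) y) \<longlonglongrightarrow> cinner (blinfun_apply L x) y" for x y
  proof (rule tendsto_of_uniform_approx)
    fix \<epsilon> :: real assume "\<epsilon> > 0"
    define t where "t = (\<lambda>m. \<Sum>i<m. cinner y (e i) *\<^sub>C e i)"
    define D where "D = C * norm x"
    have D: "D \<ge> 0" using C by (simp add: D_def)
    then have "\<epsilon> / (D + 1) > 0"
      using \<open>\<epsilon> > 0\<close> by simp
    then obtain m where m: "norm (t m - y) < \<epsilon> / (D + 1)"
      using LIMSEQ_D[OF expansion[of y]] unfolding t_def by blast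
    have "D * norm (y - t m) \<le> D * (\<epsilon> / (D + 1))"
      using m D by (intro mult_left_mono) (auto simp: norm_minus_commute)
    also have "\<dots> \<le> \<epsilon>"
      using D \<open>\<epsilon> > 0\<close> by (simp add: field_simps)
    finally have *: "D * norm (y - t m) \<le> \<epsilon>" .
    have diff: "cinner z y - cinner z (t m) = cinner z (y - t m)" for z
      using cinner_add_right[of z "y - t m" "t m"] by simp
    have "(\<lambda>n. cinner (blinfun_apply (A (s n)) x) (t m)) \<longlonglongrightarrow> cinner (blinfun_apply L x) (t m)"
      by (simp add: t_def cinner_sum_right cinner_scaleC_right L(3) tendsto_sum tendsto_mult_left f)
    moreover have "cmod (cinner (blinfun_apply (A (s n)) x) y - cinner (blinfun_apply (A (s n)) x) (t m)) \<le> \<epsilon>" for n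
      using bnd[of "s n" x "y - t m"] * by (simp add: diff D_def)
    moreover have "cmod (cinner (blinfun_apply L x) y - cinner (blinfun_apply L x) (t m)) \<le> \<epsilon>"
    proof -
      have "norm L * norm x * norm (y - t m) \<le> D * norm (y - t m)"
        unfolding D_def using L(2) by (intro mult_right_mono) auto
      then show ?thesis
        using cmod_cinner_apply_le[of L x "y - t m"] * by (simp add: diff)
    qed
    ultimately show "\<exists>v l. v \<longlonglongrightarrow> l \<and>
        (\<forall>\<^sub>F n in sequentially. cmod (cinner (blinfun_apply (A (s n)) x) y - v n) \<le> \<epsilon>) \<and>
        cmod (cinner (blinfun_apply L x) y - l) \<le> \<epsilon>"
      by (metis (mono_tags, lifting) always_eventually)
  qed
  then show thesis
    using that[of s L] s L by (simp add: wot_tendsto_def)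
qed

text \<open>Injectivity on the support of \<open>a\<close> means that each coordinate of
  \<open>x\<close> is read at most once, so Bessel gives the bound \<open>K\<close>. Suitable
  weights and index maps yield coordinate projections, rank one operators and shifts between even or
  odd coordinates and all of them.\<close>

lemma weighted_coordinate_operator:
  fixes a :: "nat \<Rightarrow> complex"
  assumes a: "\<And>j. cmod (a j) \<le> K" and inj: "inj_on \<sigma> {j. a j \<noteq> 0}"
  obtains U :: "'a \<Rightarrow>\<^sub>L 'a" where "U \<in> carrier BH" "norm U \<le> K"
    "\<And>x j. cinner (blinfun_apply U x) (e j) = a j * cinner x (e (\<sigma> j))"
proof (rule operator_of_coordinates[of "\<lambda>j x. a j * cinner x (e (\<sigma> j))" K])
  fix x N
  define M where "M = {j. j < N \<and> a j \<noteq> 0}"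
  have K: "K \<ge> 0"
    using a[of 0] norm_ge_zero order_trans by blast
  have "(\<Sum>j<N. (cmod (a j * cinner x (e (\<sigma> j))))\<^sup>2) = (\<Sum>j\<in>M. (cmod (a j * cinner x (e (\<sigma> j))))\<^sup>2)"
    by (rule sum.mono_neutral_right) (auto simp: M_def)
  also have "\<dots> \<le> (\<Sum>j\<in>M. K\<^sup>2 * (cmod (cinner x (e (\<sigma> j))))\<^sup>2)"
    by (intro sum_mono) (auto simp: norm_mult power_mult_distrib intro!: mult_right_mono power_mono a)
  also have "\<dots> = K\<^sup>2 * (\<Sum>i\<in>\<sigma> ` M. (cmod (cinner x (e i)))\<^sup>2)"
    by (subst sum.reindex) (auto simp: M_def sum_distrib_left intro: inj_on_subset[OF inj])
  also have "\<dots> \<le> K\<^sup>2 * (norm x)\<^sup>2"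
    by (intro mult_left_mono bessel) (auto simp: M_def)
  finally show "(\<Sum>j<N. (cmod (a j * cinner x (e (\<sigma> j))))\<^sup>2) \<le> (K * norm x)\<^sup>2"
    by (simp add: power_mult_distrib)
next
  show "K \<ge> 0"
    using a[of 0] norm_ge_zero order_trans by blast
qed (use that in \<open>auto simp: cinner_add_left cinner_scaleC_left ring_distribs\<close>)

text \<open>The prescribed coordinates determine the operator uniquely, so the choice is only a way
  to name it; existence comes from \<open>weighted_coordinate_operator\<close> with the indicator of
  \<open>M\<close> as weight.\<close>

definition coord_proj :: "nat set \<Rightarrow> 'a \<Rightarrow>\<^sub>L 'a" where
  "coord_proj M = (SOME U. U \<in> carrier BH \<and> norm U \<le> 1 \<and>
     (\<forall>x j. cinner (blinfun_apply U x) (e j) = (if j \<in> M then cinner x (e j) else 0)))"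

lemma coord_proj:
  shows coord_proj_carrier [simp, intro]: "coord_proj M \<in> carrier BH"
    and norm_coord_proj: "norm (coord_proj M) \<le> 1"
    and cinner_coord_proj: "cinner (blinfun_apply (coord_proj M) x) (e j) = (if j \<in> M then cinner x (e j) else 0)"
proof -
  obtain U :: "'a \<Rightarrow>\<^sub>L 'a" where "U \<in> carrier BH" "norm U \<le> 1"
    "\<And>x j. cinner (blinfun_apply U x) (e j) = indicator M j * cinner x (e (id j))"
    by (rule weighted_coordinate_operator[of "indicator M" 1 id]) (auto simp: indicator_def)
  then have "\<exists>U. U \<in> carrier BH \<and> norm U \<le> 1 \<and>
     (\<forall>x j. cinner (blinfun_apply U x) (e j) = (if j \<in> M then cinner x (e j) else 0))"
    by (intro exI[of _ U]) (auto simp: indicator_def)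
  from someI_ex[OF this]
  show "coord_proj M \<in> carrier BH" "norm (coord_proj M) \<le> 1"
    "cinner (blinfun_apply (coord_proj M) x) (e j) = (if j \<in> M then cinner x (e j) else 0)"
    unfolding coord_proj_def by blast+
qed

lemma coord_proj_lessThan_apply: "blinfun_apply (coord_proj {..<N}) x = (\<Sum>j<N. cinner x (e j) *\<^sub>C e j)"
  by (rule eqI) (simp add: cinner_coord_proj cinner_combination)

text \<open>The projections are contractions converging pointwise to the identity. Pointwise
  convergence is uniform on a finite net of the relatively compact image of the unit ball, and hence
  on the image itself.\<close>

lemma coord_proj_tendsto:
  assumes "T \<in> compact_operators"
  shows "(\<lambda>N. coord_proj {..<N} o\<^sub>L T) \<longlonglongrightarrow> T"
proof (rule LIMSEQ_I)
  fix \<epsilon> :: real assume \<epsilon>: "\<epsilon> > 0"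
  let ?K = "closure (blinfun_apply T ` cball 0 1)"
  have "compact ?K"
    using assms by (simp add: compact_operators_def)
  then obtain F where F: "finite F" "?K \<subseteq> (\<Union>y\<in>F. ball y (\<epsilon>/4))"
    using \<epsilon> unfolding compact_eq_totally_bounded by (metis zero_less_divide_iff zero_less_numeral)
  have "\<forall>\<^sub>F N in sequentially. norm (coord_proj {..<N} y - y) < \<epsilon>/4" for y
    using tendstoD[OF expansion[of y], of "\<epsilon>/4"] \<epsilon> by (simp add: coord_proj_lessThan_apply dist_norm)
  then have "\<forall>\<^sub>F N in sequentially. \<forall>y\<in>F. norm (coord_proj {..<N} y - y) < \<epsilon>/4"
    using F(1) by (simp add: eventually_ball_finite)
  then obtain n where n: "\<And>N y. N \<ge> n \<Longrightarrow> y \<in> F \<Longrightarrow> norm (coord_proj {..<N} y - y) < \<epsilon>/4"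
    by (auto simp: eventually_sequentially)
  have le: "norm ((coord_proj {..<N} o\<^sub>L T) - T) \<le> 3*\<epsilon>/4" if N: "N \<ge> n" for N
  proof (rule norm_blinfun_bound)
    fix x
    let ?Q = "blinfun_apply (coord_proj {..<N})"
    show "norm (blinfun_apply ((coord_proj {..<N} o\<^sub>L T) - T) x) \<le> 3*\<epsilon>/4 * norm x"
    proof (cases "x = 0")
      case False
      define z where "z = T (x /\<^sub>R norm x)"
      have "z \<in> ?K"
        unfolding z_def by (rule closure_subset[THEN subsetD]) (use False in auto)
      then obtain y where y: "y \<in> F" "norm (y - z) < \<epsilon>/4"
        using F(2) by (auto simp: dist_norm)
      have "norm (?Q (z - y)) \<le> 1 * norm (z - y)"
        by (meson mult_right_mono norm_blinfun norm_coord_proj norm_ge_zero order_trans)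
      moreover have "?Q z - z = ?Q (z - y) + (?Q y - y) + (y - z)"
        by (simp add: blinfun.diff_right)
      ultimately have "norm (?Q z - z) \<le> 3*\<epsilon>/4"
        using n[OF N y(1)] y(2) norm_triangle_ineq[of "?Q (z - y) + (?Q y - y)" "y - z"]
          norm_triangle_ineq[of "?Q (z - y)" "?Q y - y"] by (simp add: norm_minus_commute)
      moreover have "?Q z - z = ((coord_proj {..<N} o\<^sub>L T) - T) x /\<^sub>R norm x"
        by (simp add: z_def blinfun.scaleR_right blinfun.diff_left scaleR_diff_right)
      ultimately show ?thesis
        using False by (simp add: field_simps)
    qed (simp add: blinfun.zero_right)
  qed (use \<epsilon> in simp)
  have "norm ((coord_proj {..<N} o\<^sub>L T) - T) < \<epsilon>" if "N \<ge> n" for N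
    using le[OF that] \<epsilon> by simp
  then show "\<exists>n. \<forall>N\<ge>n. norm ((coord_proj {..<N} o\<^sub>L T) - T) < \<epsilon>"
    by blast
qed

end

section \<open>Sums of sandwiched generators\<close>

text \<open>Generators enter through an index family \<open>r\<close>, so that a list of indices
  stays fixed while a generator varies; an index may recur in the list. Bounding both the list and
  the norms by \<open>C\<close> gives pieces to which weak compactness applies.\<close>

primrec sandwich_sums :: "('i \<Rightarrow> 'a \<Rightarrow>\<^sub>L 'a) \<Rightarrow> real \<Rightarrow> 'i list \<Rightarrow> ('a::complex_hilbert_space \<Rightarrow>\<^sub>L 'a) set" where
  "sandwich_sums r C [] = {0}"
| "sandwich_sums r C (i # is) = {(A o\<^sub>L r i o\<^sub>L B) + Z | A B Z. A \<in> carrier BH \<and> B \<in> carrier BH \<and>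
     norm A \<le> C \<and> norm B \<le> C \<and> Z \<in> sandwich_sums r C is}"

lemma sandwich_sums_mono: "C \<le> D \<Longrightarrow> sandwich_sums r C is \<subseteq> sandwich_sums r D is"
  by (induction "is") (simp, fastforce)

lemma sandwich_sums_carrier:
  "(\<And>i. i \<in> set is \<Longrightarrow> r i \<in> carrier BH) \<Longrightarrow> sandwich_sums r C is \<subseteq> carrier BH"
  by (induction "is") auto

lemma sandwich_sums_append:
  "Y \<in> sandwich_sums r C is \<Longrightarrow> Z \<in> sandwich_sums r C js \<Longrightarrow> Y + Z \<in> sandwich_sums r C (is @ js)"
proof (induction "is" arbitrary: Y)
  case (Cons i "is")
  then show ?case
    by simp (metis (no_types, lifting) add.assoc)
qed simp

text \<open>Only the left factors absorb \<open>D\<close>; \<open>K \<ge> 1\<close> lets the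
  unchanged right factors satisfy the enlarged bound \<open>K * C\<close> as well.\<close>

lemma sandwich_sums_comp_left:
  assumes "D \<in> carrier BH" "norm D \<le> K" "K \<ge> 1" "C \<ge> 0"
  shows "Z \<in> sandwich_sums r C is \<Longrightarrow> D o\<^sub>L Z \<in> sandwich_sums r (K * C) is"
proof (induction "is" arbitrary: Z)
  case (Cons i "is")
  then obtain A B Y where *: "Z = (A o\<^sub>L r i o\<^sub>L B) + Y" "A \<in> carrier BH" "B \<in> carrier BH"
     "norm A \<le> C" "norm B \<le> C" "Y \<in> sandwich_sums r C is"
    by auto
  have "norm (D o\<^sub>L A) \<le> K * C"
    using norm_blinfun_compose[of D A] assms *(4)
    by (meson mult_mono norm_ge_zero order_trans)
  moreover have "norm B \<le> K * C"
    using *(5) assms mult_right_mono[of 1 K C] by simp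
  moreover have "D o\<^sub>L Z = ((D o\<^sub>L A) o\<^sub>L r i o\<^sub>L B) + (D o\<^sub>L Y)"
    by (rule blinfun_eqI) (simp add: *(1) blinfun.add_right blinfun.add_left)
  ultimately show ?case
    using *(2,3,6) Cons.IH assms(1) by (auto intro!: exI)
qed simp

lemma sandwich_sums_comp_right:
  assumes "D \<in> carrier BH" "norm D \<le> K" "K \<ge> 1" "C \<ge> 0"
  shows "Z \<in> sandwich_sums r C is \<Longrightarrow> Z o\<^sub>L D \<in> sandwich_sums r (K * C) is"
proof (induction "is" arbitrary: Z)
  case (Cons i "is")
  then obtain A B Y where *: "Z = (A o\<^sub>L r i o\<^sub>L B) + Y" "A \<in> carrier BH" "B \<in> carrier BH"
     "norm A \<le> C" "norm B \<le> C" "Y \<in> sandwich_sums r C is"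
    by auto
  have "norm (B o\<^sub>L D) \<le> K * C"
    using norm_blinfun_compose[of B D] assms *(5)
    by (metis mult.commute mult_mono norm_ge_zero order_trans)
  moreover have "norm A \<le> K * C"
    using *(4) assms mult_right_mono[of 1 K C] by simp
  moreover have "Z o\<^sub>L D = (A o\<^sub>L r i o\<^sub>L (B o\<^sub>L D)) + (Y o\<^sub>L D)"
    by (rule blinfun_eqI) (simp add: *(1) blinfun.add_right blinfun.add_left)
  ultimately show ?case
    using *(2,3,6) Cons.IH assms(1) by (auto intro!: exI)
qed simp

section \<open>Two-sided ideals of \<open>BH\<close> and their generators\<close>

lemma BH_simps [simp]:
  "x \<otimes>\<^bsub>BH\<^esub> y = x o\<^sub>L y" "x \<oplus>\<^bsub>BH\<^esub> y = x + y" "\<zero>\<^bsub>BH\<^esub> = 0" "\<one>\<^bsub>BH\<^esub> = id_blinfun"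
  by (simp_all add: BH_def)

lemma ideal_BH_closed:
  fixes I :: "('a::complex_hilbert_space \<Rightarrow>\<^sub>L 'a) set"
  assumes "ideal I BH"
  shows ideal_BH_add: "\<And>x y. x \<in> I \<Longrightarrow> y \<in> I \<Longrightarrow> x + y \<in> I"
    and ideal_BH_zero: "0 \<in> I"
    and ideal_BH_left: "\<And>x y. x \<in> carrier BH \<Longrightarrow> y \<in> I \<Longrightarrow> x o\<^sub>L y \<in> I"
    and ideal_BH_right: "\<And>x y. x \<in> I \<Longrightarrow> y \<in> carrier BH \<Longrightarrow> x o\<^sub>L y \<in> I"
    and ideal_BH_carrier: "\<And>x. x \<in> I \<Longrightarrow> x \<in> carrier BH"
  using additive_subgroup.a_closed[OF ideal.axioms(1)[OF assms]]
    additive_subgroup.zero_closed[OF ideal.axioms(1)[OF assms]]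
    ideal.I_l_closed[OF assms] ideal.I_r_closed[OF assms] ideal.Icarr[OF assms]
  by simp_all

lemma sandwich_sums_subset_ideal:
  assumes "ideal I BH"
  shows "(\<And>i. i \<in> set is \<Longrightarrow> r i \<in> I) \<Longrightarrow> sandwich_sums r C is \<subseteq> I"
proof (induction "is")
  case (Cons i "is")
  then show ?case
    by (auto intro!: ideal_BH_add[OF assms] ideal_BH_right[OF assms ideal_BH_left[OF assms]])
qed (simp add: ideal_BH_zero[OF assms])

text \<open>Negatives come from left multiplication by \<open>- id_blinfun\<close>.\<close>

lemma ideal_BH_I:
  fixes I :: "('a::complex_hilbert_space \<Rightarrow>\<^sub>L 'a) set"
  assumes carrier: "I \<subseteq> carrier BH" and zero: "0 \<in> I"
    and add: "\<And>x y. x \<in> I \<Longrightarrow> y \<in> I \<Longrightarrow> x + y \<in> I"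
    and left: "\<And>x y. x \<in> carrier BH \<Longrightarrow> y \<in> I \<Longrightarrow> x o\<^sub>L y \<in> I"
    and right: "\<And>x y. x \<in> I \<Longrightarrow> y \<in> carrier BH \<Longrightarrow> x o\<^sub>L y \<in> I"
  shows "ideal I BH"
proof (rule idealI)
  show "ring (BH :: ('a \<Rightarrow>\<^sub>L 'a) ring)" by (rule ring_BH)
  interpret ring "BH :: ('a \<Rightarrow>\<^sub>L 'a) ring" by (rule ring_BH)
  show "subgroup I (add_monoid BH)"
  proof (rule add.subgroupI)
    fix x assume x: "x \<in> I"
    have "(- id_blinfun) o\<^sub>L x = - x"
      by (rule blinfun_eqI) (simp add: blinfun.minus_left)
    then have "- x \<in> I"
      using left[OF _ x, of "- id_blinfun"] by simp
    moreover have "\<ominus>\<^bsub>BH\<^esub> x = - x"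
      using minus_equality[of "- x" x] x carrier by auto
    ultimately show "\<ominus>\<^bsub>BH\<^esub> x \<in> I" by simp
  qed (use carrier zero add in auto)
qed (use left right in auto)

text \<open>The union is itself an ideal containing the generators. Sums concatenate lists and take
  the larger bound; multiplication by an operator scales the bound by a natural number that
  dominates 1 and its norm.\<close>

lemma genideal_subset_sandwich_sums:
  fixes r :: "'i \<Rightarrow> 'a::complex_hilbert_space \<Rightarrow>\<^sub>L 'a"
  assumes r: "\<And>i. i \<in> D \<Longrightarrow> r i \<in> carrier BH"
  shows "Idl\<^bsub>BH\<^esub> (r ` D) \<subseteq> (\<Union>is\<in>lists D. \<Union>n. sandwich_sums r (real n) is)" (is "_ \<subseteq> ?U")
proof (rule ring.genideal_minimal[OF ring_BH])
  show "ideal ?U BH"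
  proof (rule ideal_BH_I)
    show "?U \<subseteq> carrier BH"
      using sandwich_sums_carrier[of _ r] r by fastforce
    show "0 \<in> ?U"
      by (intro UN_I[of "[]"]) auto
    show "x + y \<in> ?U" if xy: "x \<in> ?U" "y \<in> ?U" for x y
    proof -
      obtain "is" m js n where *: "is \<in> lists D" "x \<in> sandwich_sums r (real m) is"
        "js \<in> lists D" "y \<in> sandwich_sums r (real n) js"
        using xy by blast
      then have "x + y \<in> sandwich_sums r (real (max m n)) (is @ js)"
        by (intro sandwich_sums_append) (meson max.cobounded1 max.cobounded2 of_nat_mono sandwich_sums_mono subsetD)+
      then show ?thesis
        using * by (intro UN_I[of "is @ js"] UN_I[of "max m n"]) auto
    qed
    show "x o\<^sub>L y \<in> ?U" if xy: "x \<in> carrier BH" "y \<in> ?U" for x y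
    proof -
      obtain "is" m where *: "is \<in> lists D" "y \<in> sandwich_sums r (real m) is"
        using xy by blast
      obtain k :: nat where "max 1 (norm x) \<le> real k"
        using real_arch_simple by blast
      then have "x o\<^sub>L y \<in> sandwich_sums r (real (k * m)) is"
        using sandwich_sums_comp_left[OF xy(1), of "real k" "real m"] * by simp
      then show ?thesis
        using * by blast
    qed
    show "x o\<^sub>L y \<in> ?U" if xy: "x \<in> ?U" "y \<in> carrier BH" for x y
    proof -
      obtain "is" m where *: "is \<in> lists D" "x \<in> sandwich_sums r (real m) is"
        using xy by blast
      obtain k :: nat where "max 1 (norm y) \<le> real k"
        using real_arch_simple by blast
      then have "x o\<^sub>L y \<in> sandwich_sums r (real (k * m)) is"
        using sandwich_sums_comp_right[OF xy(2), of "real k" "real m"] * by simp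
      then show ?thesis
        using * by blast
    qed
  qed
  show "r ` D \<subseteq> ?U"
  proof (rule image_subsetI)
    fix i assume "i \<in> D"
    have "norm (id_blinfun :: 'a \<Rightarrow>\<^sub>L 'a) \<le> 1"
      by (rule norm_blinfun_bound) auto
    moreover have "(id_blinfun o\<^sub>L r i o\<^sub>L id_blinfun) + 0 = r i"
      by (rule blinfun_eqI) simp
    ultimately have "r i \<in> sandwich_sums r (real 1) [i]"
      by (auto intro!: exI[of _ id_blinfun])
    then show "r i \<in> ?U"
      using \<open>i \<in> D\<close> by (intro UN_I[of "[i]"] UN_I[of 1]) auto
  qed
qed

section \<open>Closedness of bounded sandwich sums under varying generators\<close>

context orthonormal_basis
begin

text \<open>Compactness of \<open>R'\<close> replaces it by a finite rank operator, up to an error uniform in \<open>n\<close>.\<close>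

lemma wot_tendsto_sandwich:
  fixes A B R :: "nat \<Rightarrow> 'a \<Rightarrow>\<^sub>L 'a"
  assumes A: "wot_tendsto A A'" "\<And>n. A n \<in> carrier BH" "\<And>n. norm (A n) \<le> C" "A' \<in> carrier BH" "norm A' \<le> C"
    and B: "wot_tendsto B B'" "\<And>n. norm (B n) \<le> C" "norm B' \<le> C"
    and R: "R \<longlonglongrightarrow> R'" "R' \<in> compact_operators"
  shows "wot_tendsto (\<lambda>n. A n o\<^sub>L R n o\<^sub>L B n) (A' o\<^sub>L R' o\<^sub>L B')"
  unfolding wot_tendsto_def
proof (intro allI tendsto_of_uniform_approx)
  fix x y :: 'a and \<epsilon> :: real assume \<epsilon>: "\<epsilon> > 0"
  have C: "C \<ge> 0"
    using A(5) norm_ge_zero order_trans by blast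
  have R'c: "R' \<in> carrier BH"
    using R(2) by (simp add: compact_operators_def)
  obtain S where S: "\<And>x y. cinner (blinfun_apply R' x) y = cinner x (blinfun_apply S y)"
    by (rule adjoint_exists[OF R'c]) blast
  define K where "K = C * C * norm x * norm y"
  have K: "K \<ge> 0" using C by (simp add: K_def)
  define \<delta> where "\<delta> = \<epsilon> / (K + 1)"
  have \<delta>: "\<delta> > 0" "K * \<delta> \<le> \<epsilon>"
    using \<epsilon> K by (auto simp: \<delta>_def field_simps)
  \<comment> \<open>Half of \<open>\<delta>\<close> pays for truncating \<open>R'\<close>, the other
    half for the distance from \<open>R n\<close> to \<open>R'\<close>.\<close>
  obtain m where m: "norm ((coord_proj {..<m} o\<^sub>L R') - R') < \<delta>/2"
    using LIMSEQ_D[OF coord_proj_tendsto[OF R(2)], of "\<delta>/2"] \<delta>(1) by auto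
  let ?Q = "coord_proj {..<m} o\<^sub>L R'"
  have est: "cmod (cinner (blinfun_apply (U o\<^sub>L X o\<^sub>L V) x) y - cinner (blinfun_apply (U o\<^sub>L ?Q o\<^sub>L V) x) y) \<le> \<epsilon>"
    if "norm U \<le> C" "norm V \<le> C" "norm (X - ?Q) \<le> \<delta>" for U V X :: "'a \<Rightarrow>\<^sub>L 'a"
  proof -
    have "norm (U o\<^sub>L (X - ?Q) o\<^sub>L V) \<le> norm U * norm (X - ?Q) * norm V"
      by (meson mult_right_mono norm_blinfun_compose norm_ge_zero order_trans)
    also have "\<dots> \<le> C * \<delta> * C"
      using that C \<delta>(1) by (intro mult_mono) auto
    finally have "norm (U o\<^sub>L (X - ?Q) o\<^sub>L V) * norm x * norm y \<le> C * \<delta> * C * norm x * norm y"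
      by (intro mult_right_mono) auto
    also have "\<dots> = K * \<delta>" by (simp add: K_def)
    finally have "cmod (cinner (blinfun_apply (U o\<^sub>L (X - ?Q) o\<^sub>L V) x) y) \<le> \<epsilon>"
      using \<delta>(2) cmod_cinner_apply_le[of "U o\<^sub>L (X - ?Q) o\<^sub>L V" x y] by linarith
    then show ?thesis
      by (simp add: blinfun.diff_left blinfun.diff_right cinner_diff_left)
  qed
  \<comment> \<open>Composition is not jointly weakly continuous; with the truncated middle factor,
    however, the pairing is a finite sum of products of two scalars, each converging weakly.\<close>
  have Qsum: "cinner (blinfun_apply (U o\<^sub>L ?Q o\<^sub>L V) x) y =
      (\<Sum>i<m. cinner (blinfun_apply V x) (blinfun_apply S (e i)) * cinner (blinfun_apply U (e i)) y)"
    if "U \<in> carrier BH" for U V :: "'a \<Rightarrow>\<^sub>L 'a"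
    by (simp add: coord_proj_lessThan_apply apply_combination[OF that] cinner_sum_left cinner_scaleC_left S)
  have "(\<lambda>n. cinner (blinfun_apply (A n o\<^sub>L ?Q o\<^sub>L B n) x) y) \<longlonglongrightarrow> cinner (blinfun_apply (A' o\<^sub>L ?Q o\<^sub>L B') x) y"
    unfolding Qsum[OF A(2)] Qsum[OF A(4)]
    using A(1) B(1) by (intro tendsto_sum tendsto_mult) (auto simp: wot_tendsto_def)
  moreover have "\<forall>\<^sub>F n in sequentially. cmod (cinner (blinfun_apply (A n o\<^sub>L R n o\<^sub>L B n) x) y
      - cinner (blinfun_apply (A n o\<^sub>L ?Q o\<^sub>L B n) x) y) \<le> \<epsilon>"
  proof -
    have "\<forall>\<^sub>F n in sequentially. norm (R n - R') < \<delta>/2"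
      using tendstoD[OF R(1), of "\<delta>/2"] \<delta>(1) by (simp add: dist_norm)
    then show ?thesis
    proof eventually_elim
      case (elim n)
      then have "norm (R n - ?Q) \<le> \<delta>"
        using m norm_triangle_ineq[of "R n - R'" "R' - ?Q"] by (simp add: norm_minus_commute)
      then show ?case
        by (intro est A B)
    qed
  qed
  moreover have "cmod (cinner (blinfun_apply (A' o\<^sub>L R' o\<^sub>L B') x) y - cinner (blinfun_apply (A' o\<^sub>L ?Q o\<^sub>L B') x) y) \<le> \<epsilon>"
    using m \<delta>(1) by (intro est A B) (simp add: norm_minus_commute)
  ultimately show "\<exists>v l. v \<longlonglongrightarrow> l \<and>
      (\<forall>\<^sub>F n in sequentially. cmod (cinner (blinfun_apply (A n o\<^sub>L R n o\<^sub>L B n) x) y - v n) \<le> \<epsilon>) \<and>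
      cmod (cinner (blinfun_apply (A' o\<^sub>L R' o\<^sub>L B') x) y - l) \<le> \<epsilon>"
    by blast
qed

text \<open>Induction on the list: subsequences are extracted in turn for the left factors, the
  right factors and the remaining sum. The family \<open>r\<close> is generalized because the
  induction hypothesis is applied along a subsequence of it.\<close>

lemma sandwich_sums_wot_compact:
  fixes r :: "nat \<Rightarrow> 'i \<Rightarrow> 'a \<Rightarrow>\<^sub>L 'a"
  assumes "\<And>i. i \<in> set is \<Longrightarrow> (\<lambda>n. r n i) \<longlonglongrightarrow> r' i"
    and "\<And>i. i \<in> set is \<Longrightarrow> r' i \<in> compact_operators"
    and "\<And>n. Z n \<in> sandwich_sums (r n) C is"
  shows "\<exists>s L. strict_mono s \<and> L \<in> sandwich_sums r' C is \<and> wot_tendsto (Z \<circ> s) L"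
  using assms
proof (induction "is" arbitrary: r Z)
  case Nil
  then have "wot_tendsto (Z \<circ> id) 0"
    by (simp add: wot_tendsto_def)
  then show ?case
    using strict_mono_id by fastforce
next
  case (Cons i "is")
  have "\<forall>n. \<exists>A B Y. Z n = (A o\<^sub>L r n i o\<^sub>L B) + Y \<and> A \<in> carrier BH \<and> B \<in> carrier BH \<and>
     norm A \<le> C \<and> norm B \<le> C \<and> Y \<in> sandwich_sums (r n) C is"
    using Cons.prems(3) by simp
  then obtain A B Y where Z: "\<And>n. Z n = (A n o\<^sub>L r n i o\<^sub>L B n) + Y n"
    and A: "\<And>n. A n \<in> carrier BH" "\<And>n. norm (A n) \<le> C"
    and B: "\<And>n. B n \<in> carrier BH" "\<And>n. norm (B n) \<le> C"
    and Y: "\<And>n. Y n \<in> sandwich_sums (r n) C is"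
    by metis
  obtain s1 A' where s1: "strict_mono s1" and A': "A' \<in> carrier BH" "norm A' \<le> C" "wot_tendsto (A \<circ> s1) A'"
    by (rule weak_operator_compactness[OF A])
  obtain s2 B' where s2: "strict_mono s2" and B': "B' \<in> carrier BH" "norm B' \<le> C" "wot_tendsto (B \<circ> s1 \<circ> s2) B'"
    by (rule weak_operator_compactness[of "B \<circ> s1" C]) (use B in auto)
  have s12: "strict_mono (s1 \<circ> s2)"
    using s1 s2 by (rule strict_mono_o)
  have r: "(\<lambda>n. r ((s1 \<circ> s2) n) k) \<longlonglongrightarrow> r' k" if "k \<in> set (i # is)" for k
    using LIMSEQ_subseq_LIMSEQ[OF Cons.prems(1)[OF that] s12] by (simp add: o_def)
  have "\<exists>s3 Y'. strict_mono s3 \<and> Y' \<in> sandwich_sums r' C is \<and> wot_tendsto (Y \<circ> (s1 \<circ> s2) \<circ> s3) Y'"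
    by (rule Cons.IH[of "r \<circ> (s1 \<circ> s2)"]) (use r Y Cons.prems(2) in auto)
  then obtain s3 Y' where s3: "strict_mono s3"
    and Y': "Y' \<in> sandwich_sums r' C is" "wot_tendsto (Y \<circ> (s1 \<circ> s2) \<circ> s3) Y'"
    by blast
  define s where "s = s1 \<circ> s2 \<circ> s3"
  have s: "strict_mono s"
    unfolding s_def by (intro strict_mono_o s1 s2 s3)
  have As: "wot_tendsto (A \<circ> s) A'"
    using wot_tendsto_subseq[OF A'(3) strict_mono_o[OF s2 s3]] by (simp add: s_def o_assoc)
  have Bs: "wot_tendsto (B \<circ> s) B'"
    using wot_tendsto_subseq[OF B'(3) s3] by (simp add: s_def o_assoc)
  have rs: "(\<lambda>n. r (s n) i) \<longlonglongrightarrow> r' i"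
    using LIMSEQ_subseq_LIMSEQ[OF Cons.prems(1) s, of i] by (simp add: o_def)
  have "wot_tendsto (\<lambda>n. (A \<circ> s) n o\<^sub>L r (s n) i o\<^sub>L (B \<circ> s) n) (A' o\<^sub>L r' i o\<^sub>L B')"
    by (rule wot_tendsto_sandwich[OF As _ _ A'(1,2) Bs _ B'(2) rs]) (use A B Cons.prems(2) in auto)
  from wot_tendsto_add[OF this Y'(2)]
  have "wot_tendsto (Z \<circ> s) ((A' o\<^sub>L r' i o\<^sub>L B') + Y')"
    by (simp add: Z s_def o_def)
  moreover have "(A' o\<^sub>L r' i o\<^sub>L B') + Y' \<in> sandwich_sums r' C (i # is)"
    using A' B' Y' by auto
  ultimately show ?case
    using s by blast
qed

text \<open>A norm limit is also the weak limit of every subsequence, so it coincides with the weak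
  limit found inside the set.\<close>

lemma sandwich_sums_closed:
  fixes r :: "nat \<Rightarrow> 'i \<Rightarrow> 'a \<Rightarrow>\<^sub>L 'a"
  assumes "\<And>i. i \<in> set is \<Longrightarrow> (\<lambda>n. r n i) \<longlonglongrightarrow> r' i"
    and "\<And>i. i \<in> set is \<Longrightarrow> r' i \<in> compact_operators"
    and "\<And>n. Z n \<in> sandwich_sums (r n) C is" and "Z \<longlonglongrightarrow> Z'"
  shows "Z' \<in> sandwich_sums r' C is"
proof -
  obtain s L where s: "strict_mono s" "L \<in> sandwich_sums r' C is" "wot_tendsto (Z \<circ> s) L"
    using sandwich_sums_wot_compact[of "is" r r' Z C] assms(1-3) by blast
  have "wot_tendsto (Z \<circ> s) Z'"
    by (intro wot_tendsto_subseq tendsto_imp_wot_tendsto assms(4) s(1))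
  with s wot_limit_unique show ?thesis by blast
qed

end

section \<open>A generic intermediate generator\<close>

context orthonormal_basis
begin

lemma nonzero_entry:
  fixes S :: "'a \<Rightarrow>\<^sub>L 'a"
  assumes S: "S \<in> carrier BH" "S \<noteq> 0"
  obtains k i where "cinner (blinfun_apply S (e k)) (e i) \<noteq> 0"
proof (rule ccontr)
  assume "\<not> thesis"
  then have "blinfun_apply S (e k) = 0" for k
    using that total by blast
  then have "blinfun_apply S (\<Sum>j<N. cinner x (e j) *\<^sub>C e j) = 0" for x N
    by (simp add: apply_combination[OF S(1)])
  moreover have "(\<lambda>N. blinfun_apply S (\<Sum>j<N. cinner x (e j) *\<^sub>C e j)) \<longlonglongrightarrow> blinfun_apply S x" for x
    by (intro blinfun.tendsto tendsto_const expansion)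
  ultimately have "blinfun_apply S x = 0" for x
    by (simp add: LIMSEQ_const_iff)
  then have "S = 0"
    by (intro blinfun_eqI) simp
  with S(2) show False by simp
qed

text \<open>A nonzero operator has a nonzero matrix entry; cutting it out by rank one operators on
  both sides yields the projection onto any one basis vector, and finite sums give the rest.\<close>

lemma coord_proj_finite_in_ideal:
  assumes I: "ideal I BH" and nz: "I \<noteq> {0}" and "finite F"
  shows "coord_proj F \<in> I"
proof -
  obtain S where S: "S \<in> I" "S \<noteq> 0"
    using nz ideal_BH_zero[OF I] by blast
  obtain k i where c: "cinner (blinfun_apply S (e k)) (e i) \<noteq> 0"
    using nonzero_entry[OF ideal_BH_carrier[OF I S(1)] S(2)] .
  define c where "c = cinner (blinfun_apply S (e k)) (e i)"
  have single: "coord_proj {j} \<in> I" for j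
  proof -
    \<comment> \<open>\<open>U\<close> moves coordinate \<open>i\<close> to position
      \<open>j\<close> and divides by the entry \<open>c\<close>; \<open>V\<close> below sends
      \<open>e j\<close> to \<open>e k\<close> and the other basis vectors to 0. Hence
      \<open>U\<close>, \<open>S\<close>, \<open>V\<close> compose to
      \<open>coord_proj {j}\<close>.\<close>
    obtain U :: "'a \<Rightarrow>\<^sub>L 'a" where U: "U \<in> carrier BH"
      "\<And>x l. cinner (blinfun_apply U x) (e l) = (if l = j then 1 / c else 0) * cinner x (e i)"
      by (rule weighted_coordinate_operator[of "\<lambda>l. if l = j then 1 / c else 0" "cmod (1 / c)" "\<lambda>_. i"])
        (auto simp: inj_on_def)
    obtain V :: "'a \<Rightarrow>\<^sub>L 'a" where V: "V \<in> carrier BH"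
      "\<And>x l. cinner (blinfun_apply V x) (e l) = (if l = k then 1 else 0) * cinner x (e j)"
      by (rule weighted_coordinate_operator[of "\<lambda>l. if l = k then 1 else 0" 1 "\<lambda>_. j"])
        (auto simp: inj_on_def)
    have Vx: "blinfun_apply V x = cinner x (e j) *\<^sub>C e k" for x
      by (rule eqI) (simp add: V(2) cinner_scaleC_left cinner_basis)
    have "U o\<^sub>L S o\<^sub>L V = coord_proj {j}"
    proof (rule blinfun_eqI, rule eqI)
      fix x l
      have "blinfun_apply S (cinner x (e j) *\<^sub>C e k) = cinner x (e j) *\<^sub>C blinfun_apply S (e k)"
        using ideal_BH_carrier[OF I S(1)] by (simp add: carrier_BH)
      then show "cinner (blinfun_apply (U o\<^sub>L S o\<^sub>L V) x) (e l) = cinner (blinfun_apply (coord_proj {j}) x) (e l)"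
        using c by (simp add: cinner_coord_proj U(2) Vx cinner_scaleC_left flip: c_def)
    qed
    moreover have "U o\<^sub>L S o\<^sub>L V \<in> I"
      by (intro ideal_BH_right[OF I] ideal_BH_left[OF I] U(1) V(1) S(1))
    ultimately show ?thesis by simp
  qed
  show ?thesis
    using \<open>finite F\<close>
  proof (induction F)
    case empty
    have "coord_proj {} = 0"
      by (rule blinfun_eqI, rule eqI) (simp add: cinner_coord_proj)
    then show ?case
      by (simp add: ideal_BH_zero[OF I])
  next
    case (insert j F)
    have "coord_proj (insert j F) = coord_proj {j} + coord_proj F"
      by (rule blinfun_eqI, rule eqI)
        (use insert.hyps in \<open>auto simp: cinner_coord_proj blinfun.add_left cinner_add_left\<close>)
    then show ?case
      using ideal_BH_add[OF I single insert.IH] by simp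
  qed
qed

text \<open>Membership becomes a condition on each coordinate separately, built from equations
  continuous in \<open>X\<close>, which makes closedness visible.\<close>

lemma range_coord_proj_comp:
  fixes T :: "'a \<Rightarrow>\<^sub>L 'a"
  shows "range (\<lambda>M. coord_proj M o\<^sub>L T) =
    {X. \<forall>j. (\<forall>x. cinner (blinfun_apply X x) (e j) = 0) \<or>
             (\<forall>x. cinner (blinfun_apply X x) (e j) = cinner (blinfun_apply T x) (e j))}" (is "_ = ?R")
proof (intro equalityI subsetI)
  fix X assume X: "X \<in> ?R"
  let ?M = "{j. \<forall>x. cinner (blinfun_apply X x) (e j) = cinner (blinfun_apply T x) (e j)}"
  have "X = coord_proj ?M o\<^sub>L T"
    by (rule blinfun_eqI, rule eqI) (use X in \<open>auto simp: cinner_coord_proj\<close>)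
  then show "X \<in> range (\<lambda>M. coord_proj M o\<^sub>L T)" by blast
qed (auto simp: cinner_coord_proj)

lemma closed_range_coord_proj_comp:
  fixes T :: "'a \<Rightarrow>\<^sub>L 'a"
  shows "closed (range (\<lambda>M. coord_proj M o\<^sub>L T))"
proof -
  have "continuous_on UNIV (\<lambda>X :: 'a \<Rightarrow>\<^sub>L 'a. cinner (blinfun_apply X x) (e j))" for x j
    by (intro linear_continuous_on bounded_linear_compose[OF bounded_linear_cinner_left]
        blinfun.bounded_linear_left)
  then show ?thesis
    unfolding range_coord_proj_comp
    by (intro closed_Collect_all closed_Collect_disj closed_Collect_eq continuous_on_const)
qed

text \<open>Below \<open>n\<close> the two projections agree. From \<open>n\<close> on, each
  coordinate of the difference is 0 or, up to sign, that of \<open>T x\<close>, which is also the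
  size of the coordinate on the right.\<close>

lemma norm_coord_proj_comp_diff_le:
  assumes "M \<inter> {..<n} = M' \<inter> {..<n}"
  shows "norm ((coord_proj M o\<^sub>L T) - (coord_proj M' o\<^sub>L T)) \<le> norm ((coord_proj {..<n} o\<^sub>L T) - T)"
proof (rule norm_blinfun_bound)
  fix x
  have "norm (blinfun_apply ((coord_proj M o\<^sub>L T) - (coord_proj M' o\<^sub>L T)) x)
      \<le> norm (blinfun_apply ((coord_proj {..<n} o\<^sub>L T) - T) x)"
  proof (rule norm_mono)
    fix j
    have "j \<in> M \<longleftrightarrow> j \<in> M'" if "j < n"
      using assms that by blast
    then show "cmod (cinner (blinfun_apply ((coord_proj M o\<^sub>L T) - (coord_proj M' o\<^sub>L T)) x) (e j))
        \<le> cmod (cinner (blinfun_apply ((coord_proj {..<n} o\<^sub>L T) - T) x) (e j))"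
      by (auto simp: blinfun.diff_left cinner_diff_left cinner_coord_proj)
  qed
  also have "\<dots> \<le> norm ((coord_proj {..<n} o\<^sub>L T) - T) * norm x"
    by (rule norm_blinfun)
  finally show "norm (blinfun_apply ((coord_proj M o\<^sub>L T) - (coord_proj M' o\<^sub>L T)) x)
      \<le> norm ((coord_proj {..<n} o\<^sub>L T) - T) * norm x" .
qed simp

end

lemma interior_of_top_of_set_eq_empty:
  fixes S :: "'b::metric_space set"
  assumes "\<And>x \<epsilon>. x \<in> S \<Longrightarrow> \<epsilon> > 0 \<Longrightarrow> \<exists>y\<in>S. dist y x < \<epsilon> \<and> y \<notin> B"
  shows "top_of_set S interior_of B = {}"
proof (intro equals0I)
  fix x assume "x \<in> top_of_set S interior_of B"
  then obtain U where "openin (top_of_set S) U" "x \<in> U" "U \<subseteq> B"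
    by (auto simp: interior_of_def)
  then obtain \<epsilon> where "x \<in> S" "\<epsilon> > 0" "\<And>y. y \<in> S \<Longrightarrow> dist y x < \<epsilon> \<Longrightarrow> y \<in> B"
    unfolding openin_euclidean_subtopology_iff by (meson subsetD)
  with assms show False by metis
qed

section \<open>The Baire category argument and the resulting intermediate ideals\<close>

context orthonormal_basis
begin

lemma generic_coord_proj:
  fixes I J :: "('a \<Rightarrow>\<^sub>L 'a) set"
  assumes I: "ideal I BH" "I \<noteq> {0}" "I = Idl\<^bsub>BH\<^esub> S" and S: "countable S" "S \<subseteq> carrier BH"
    and J: "ideal J BH" "J \<subseteq> compact_operators" "I \<subseteq> J" and T: "T \<in> J" "T \<notin> I"
  obtains M where "coord_proj M o\<^sub>L T \<notin> I" "T \<notin> Idl\<^bsub>BH\<^esub> (insert (coord_proj M o\<^sub>L T) S)"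
proof -
  define XX where "XX = range (\<lambda>M. coord_proj M o\<^sub>L T)"
  \<comment> \<open>The sets in \<open>\<B>1\<close> cover the part of \<open>XX\<close> inside
    \<open>I\<close>; those in \<open>\<B>2\<close> cover every \<open>X\<close> for which
    \<open>T\<close> lies in the ideal generated by \<open>insert X S\<close>. An \<open>X\<close>
    outside all of them is wanted.\<close>
  define \<B>1 where "\<B>1 = (\<lambda>(Rs, n). {X \<in> XX. X \<in> sandwich_sums id (real n) Rs}) ` (lists S \<times> UNIV)"
  \<comment> \<open>The index \<open>None\<close> stands for the varying generator \<open>X\<close>, \<open>Some R\<close> for a fixed generator \<open>R\<close>.\<close>
  define \<B>2 where "\<B>2 = (\<lambda>(os, n). {X \<in> XX. T \<in> sandwich_sums (case_option X id) (real n) os}) `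
    (lists (insert None (Some ` S)) \<times> UNIV)"
  have SI: "S \<subseteq> I"
    unfolding I(3) by (rule ring.genideal_self[OF ring_BH S(2)])
  have XJ: "XX \<subseteq> J"
    using T(1) by (auto simp: XX_def intro: ideal_BH_left[OF J(1)])
  have closed: "closed XX"
    unfolding XX_def by (rule closed_range_coord_proj_comp)
  have tail: "\<exists>n. norm ((coord_proj {..<n} o\<^sub>L T) - T) < \<epsilon>" if "\<epsilon> > 0" for \<epsilon>
    using LIMSEQ_D[OF coord_proj_tendsto that] T(1) J(2) by blast
  have "top_of_set XX interior_of \<Union>(\<B>1 \<union> \<B>2) = {}"
  proof (rule Baire_category_alt)
    \<comment> \<open>\<open>XX\<close> is closed in the complete space of bounded
      operators.\<close>
    show "completely_metrizable_space (top_of_set XX) \<or> locally_compact_space (top_of_set XX) \<and> regular_space (top_of_set XX)"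
      using closed closed_closedin completely_metrizable_space_closedin completely_metrizable_space_euclidean by blast
    show "countable (\<B>1 \<union> \<B>2)"
      unfolding \<B>1_def \<B>2_def by (intro countable_Un countable_image countable_SIGMA countable_lists countable_insert S(1)) auto
    fix B assume "B \<in> \<B>1 \<union> \<B>2"
    then show "closedin (top_of_set XX) B \<and> top_of_set XX interior_of B = {}"
    proof
      assume "B \<in> \<B>1"
      then obtain Rs n where Rs: "Rs \<in> lists S" and B: "B = {X \<in> XX. X \<in> sandwich_sums id (real n) Rs}"
        unfolding \<B>1_def by auto
      have RsI: "id R \<in> I" if "R \<in> set Rs" for R
        using Rs that SI by auto
      have "closed (sandwich_sums id (real n) Rs)"
        unfolding closed_sequential_limits
      proof (intro allI impI, elim conjE)
        fix Z Z' assume Z: "\<forall>k. Z k \<in> sandwich_sums id (real n) Rs" "Z \<longlonglongrightarrow> Z'"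
        show "Z' \<in> sandwich_sums id (real n) Rs"
        proof (rule sandwich_sums_closed[OF _ _ _ Z(2), where r = "\<lambda>_. id"])
          show "id R \<in> compact_operators" if "R \<in> set Rs" for R
            using RsI[OF that] J(2,3) by blast
        qed (use Z(1) in simp_all)
      qed
      then have "closed B"
        using closed unfolding B by (simp add: Collect_conj_eq closed_Int)
      then have "closedin (top_of_set XX) B"
        by (intro closed_subset) (auto simp: B)
      moreover have "top_of_set XX interior_of B = {}"
      proof (rule interior_of_top_of_set_eq_empty)
        fix X and \<epsilon> :: real assume "X \<in> XX" "\<epsilon> > 0"
        then obtain M where M: "X = coord_proj M o\<^sub>L T" by (auto simp: XX_def)
        obtain m where m: "norm ((coord_proj {..<m} o\<^sub>L T) - T) < \<epsilon>"
          using tail[OF \<open>\<epsilon> > 0\<close>] by blast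
        \<comment> \<open>\<open>Y\<close> keeps \<open>M\<close> below \<open>m\<close> and
          contains every later index. It misses only a finite rank part of \<open>T\<close>, which
          lies in \<open>I\<close>, so \<open>Y \<in> I\<close> would force
          \<open>T \<in> I\<close>.\<close>
        define Y where "Y = coord_proj (M \<inter> {..<m} \<union> {m..}) o\<^sub>L T"
        have "norm (Y - X) \<le> norm ((coord_proj {..<m} o\<^sub>L T) - T)"
          unfolding Y_def M by (rule norm_coord_proj_comp_diff_le) auto
        then have "dist Y X < \<epsilon>"
          using m by (simp add: dist_norm)
        moreover have "Y \<notin> I"
        proof
          assume "Y \<in> I"
          moreover have "coord_proj ({..<m} - M) o\<^sub>L T \<in> I"
            using T(1) by (intro ideal_BH_right[OF I(1)] coord_proj_finite_in_ideal[OF I(1,2)] ideal_BH_carrier[OF J(1)]) auto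
          ultimately have "Y + (coord_proj ({..<m} - M) o\<^sub>L T) \<in> I"
            by (rule ideal_BH_add[OF I(1)])
          moreover have "Y + (coord_proj ({..<m} - M) o\<^sub>L T) = T"
            by (rule blinfun_eqI, rule eqI)
              (auto simp: Y_def blinfun.add_left cinner_add_left cinner_coord_proj)
          ultimately show False
            using T(2) by simp
        qed
        then have "Y \<notin> B"
          using sandwich_sums_subset_ideal[OF I(1), of Rs id "real n"] RsI by (auto simp: B)
        ultimately show "\<exists>Y\<in>XX. dist Y X < \<epsilon> \<and> Y \<notin> B"
          by (auto simp: XX_def Y_def)
      qed
      ultimately show ?thesis by blast
    next
      assume "B \<in> \<B>2"
      then obtain os n where os: "os \<in> lists (insert None (Some ` S))"
        and B: "B = {X \<in> XX. T \<in> sandwich_sums (case_option X id) (real n) os}"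
        unfolding \<B>2_def by auto
      have osJ: "case_option X id p \<in> K" if "p \<in> set os" "X \<in> K" "S \<subseteq> K" for X p and K :: "('a \<Rightarrow>\<^sub>L 'a) set"
        using os that by (cases p) auto
      have "closed B"
        unfolding closed_sequential_limits
      proof (intro allI impI, elim conjE)
        fix X X' assume X: "\<forall>k. X k \<in> B" "X \<longlonglongrightarrow> X'"
        have X': "X' \<in> XX"
          using closed X unfolding closed_sequential_limits B by blast
        have "T \<in> sandwich_sums (case_option X' id) (real n) os"
        proof (rule sandwich_sums_closed[where Z = "\<lambda>_. T" and r = "\<lambda>k. case_option (X k) id"])
          fix p assume p: "p \<in> set os"
          show "(\<lambda>k. case_option (X k) id p) \<longlonglongrightarrow> case_option X' id p"
            using X(2) by (cases p) auto
          show "case_option X' id p \<in> compact_operators"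
            using osJ[OF p, of X' J] X' XJ SI J(2,3) by blast
        qed (use X(1) in \<open>auto simp: B\<close>)
        with X' show "X' \<in> B" by (simp add: B)
      qed
      then have "closedin (top_of_set XX) B"
        by (intro closed_subset) (auto simp: B)
      moreover have "top_of_set XX interior_of B = {}"
      proof (rule interior_of_top_of_set_eq_empty)
        fix X and \<epsilon> :: real assume "X \<in> XX" "\<epsilon> > 0"
        then obtain M where M: "X = coord_proj M o\<^sub>L T" by (auto simp: XX_def)
        obtain m where m: "norm ((coord_proj {..<m} o\<^sub>L T) - T) < \<epsilon>"
          using tail[OF \<open>\<epsilon> > 0\<close>] by blast
        \<comment> \<open>The opposite modification: dropping all indices from \<open>m\<close> on
          makes \<open>Y\<close> of finite rank and hence a member of \<open>I\<close>, so that all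
          generators lie in \<open>I\<close> while \<open>T\<close> does not.\<close>
        define Y where "Y = coord_proj (M \<inter> {..<m}) o\<^sub>L T"
        have "norm (Y - X) \<le> norm ((coord_proj {..<m} o\<^sub>L T) - T)"
          unfolding Y_def M by (rule norm_coord_proj_comp_diff_le) auto
        then have "dist Y X < \<epsilon>"
          using m by (simp add: dist_norm)
        moreover have "Y \<in> I"
          unfolding Y_def using T(1)
          by (intro ideal_BH_right[OF I(1)] coord_proj_finite_in_ideal[OF I(1,2)] ideal_BH_carrier[OF J(1)]) auto
        then have "sandwich_sums (case_option Y id) (real n) os \<subseteq> I"
          by (intro sandwich_sums_subset_ideal[OF I(1)] osJ SI)
        then have "Y \<notin> B"
          using T(2) by (auto simp: B)
        ultimately show "\<exists>Y\<in>XX. dist Y X < \<epsilon> \<and> Y \<notin> B"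
          by (auto simp: XX_def Y_def)
      qed
      ultimately show ?thesis by blast
    qed
  qed
  \<comment> \<open>Relative to itself \<open>XX\<close> is its own interior; being nonempty, it
    cannot be contained in a union with empty interior.\<close>
  moreover have "top_of_set XX interior_of XX = XX"
    using interior_of_topspace[of "top_of_set XX"] by simp
  moreover have "XX \<noteq> {}"
    by (simp add: XX_def)
  ultimately obtain X where X: "X \<in> XX" "X \<notin> \<Union>(\<B>1 \<union> \<B>2)"
    using interior_of_mono[of XX "\<Union>(\<B>1 \<union> \<B>2)" "top_of_set XX"] by fastforce
  have "X \<notin> I"
  proof
    assume "X \<in> I"
    then have "X \<in> Idl\<^bsub>BH\<^esub> (id ` S)"
      by (simp add: I(3))
    then obtain Rs n where "Rs \<in> lists S" "X \<in> sandwich_sums id (real n) Rs"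
      using genideal_subset_sandwich_sums[of S id] S(2) by auto
    then show False
      using X unfolding \<B>1_def by auto
  qed
  moreover have "T \<notin> Idl\<^bsub>BH\<^esub> (insert X S)"
  proof
    assume T_in: "T \<in> Idl\<^bsub>BH\<^esub> (insert X S)"
    have eq: "insert X S = case_option X id ` insert None (Some ` S)"
      by (simp add: image_image)
    have "case_option X id p \<in> carrier BH" if "p \<in> insert None (Some ` S)" for p
      using that S(2) X(1) XJ ideal_BH_carrier[OF J(1)] by auto
    from subsetD[OF genideal_subset_sandwich_sums[OF this] T_in[unfolded eq]]
    obtain os n where "os \<in> lists (insert None (Some ` S))"
        "T \<in> sandwich_sums (case_option X id) (real n) os"
      by blast
    then show False
      using X unfolding \<B>2_def by blast
  qed
  ultimately show thesis
    using X(1) that by (auto simp: XX_def)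
qed

lemma intermediate_genideal:
  fixes I J :: "('a \<Rightarrow>\<^sub>L 'a) set"
  assumes I: "I \<in> nonzero_ideals" "I = Idl\<^bsub>BH\<^esub> S" and S: "countable S" "S \<subseteq> carrier BH"
    and J: "J \<in> nonzero_ideals" and IJ: "I \<subset> J"
  obtains X where "X \<in> carrier BH" "Idl\<^bsub>BH\<^esub> (insert X S) \<in> nonzero_ideals"
    "I \<subset> Idl\<^bsub>BH\<^esub> (insert X S)" "Idl\<^bsub>BH\<^esub> (insert X S) \<subset> J"
proof -
  have I': "ideal I BH" "I \<noteq> {0}" and J': "ideal J BH" "J \<subseteq> compact_operators" "I \<subseteq> J"
    using I(1) J IJ by (auto simp: nonzero_ideals_def)
  obtain T where T: "T \<in> J" "T \<notin> I"
    using IJ by blast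
  obtain M where M: "coord_proj M o\<^sub>L T \<notin> I" "T \<notin> Idl\<^bsub>BH\<^esub> (insert (coord_proj M o\<^sub>L T) S)"
    by (rule generic_coord_proj[OF I' I(2) S J' T])
  define X where "X = coord_proj M o\<^sub>L T"
  define L where "L = Idl\<^bsub>BH\<^esub> (insert X S)"
  interpret ring "BH :: ('a \<Rightarrow>\<^sub>L 'a) ring" by (rule ring_BH)
  have XJ: "X \<in> J"
    unfolding X_def by (rule ideal_BH_left[OF J'(1) _ T(1)]) simp
  have carr: "X \<in> carrier BH" "insert X S \<subseteq> carrier BH"
    using ideal_BH_carrier[OF J'(1) XJ] S(2) by auto
  have L: "ideal L BH" "insert X S \<subseteq> L"
    unfolding L_def by (rule genideal_ideal genideal_self, rule carr)+
  have "I \<subseteq> L"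
    unfolding I(2) using L by (intro genideal_minimal) auto
  then have IL: "I \<subset> L"
    using M(1) L(2) by (auto simp: X_def)
  have "S \<subseteq> J"
    using genideal_self[OF S(2)] J'(3) I(2) by blast
  then have "L \<subseteq> J"
    unfolding L_def using XJ by (intro genideal_minimal J') auto
  then have LJ: "L \<subset> J"
    using M(2) T(1) by (auto simp: L_def X_def)
  have "L \<in> nonzero_ideals"
    using L(1) LJ J'(2) IL I'(2) ideal_BH_zero[OF I'(1)] by (auto simp: nonzero_ideals_def)
  then show thesis
    using that carr(1) IL LJ unfolding L_def by blast
qed

text \<open>\<open>V1\<close> and \<open>V2\<close> embed the space isometrically onto the even and
  the odd coordinates, with left inverses \<open>W1\<close> and \<open>W2\<close>. The generator
  \<open>W\<close> is the direct sum of \<open>S\<close> and \<open>X\<close> along this splitting,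
  and compressing it recovers both summands.\<close>

lemma genideal_pair_principal:
  fixes S X :: "'a \<Rightarrow>\<^sub>L 'a"
  assumes S: "S \<in> carrier BH" and X: "X \<in> carrier BH"
  obtains W :: "'a \<Rightarrow>\<^sub>L 'a" where "W \<in> carrier BH" "Idl\<^bsub>BH\<^esub> {X, S} = Idl\<^bsub>BH\<^esub> {W}"
proof -
  interpret ring "BH :: ('a \<Rightarrow>\<^sub>L 'a) ring" by (rule ring_BH)
  have inj: "inj_on (\<lambda>j. j div 2) {j :: nat. (if even j then 1 else 0) \<noteq> (0::complex)}"
    "inj_on (\<lambda>j. j div 2) {j :: nat. (if odd j then 1 else 0) \<noteq> (0::complex)}"
    by (rule inj_onI, simp split: if_splits, presburger)+
  obtain V1 :: "'a \<Rightarrow>\<^sub>L 'a" where V1: "V1 \<in> carrier BH"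
    "\<And>x j. cinner (blinfun_apply V1 x) (e j) = (if even j then 1 else 0) * cinner x (e (j div 2))"
    by (rule weighted_coordinate_operator[OF _ inj(1), of 1]) auto
  obtain V2 :: "'a \<Rightarrow>\<^sub>L 'a" where V2: "V2 \<in> carrier BH"
    "\<And>x j. cinner (blinfun_apply V2 x) (e j) = (if odd j then 1 else 0) * cinner x (e (j div 2))"
    by (rule weighted_coordinate_operator[OF _ inj(2), of 1]) auto
  obtain W1 :: "'a \<Rightarrow>\<^sub>L 'a" where W1: "W1 \<in> carrier BH"
    "\<And>x j. cinner (blinfun_apply W1 x) (e j) = 1 * cinner x (e (2 * j))"
    by (rule weighted_coordinate_operator[of "\<lambda>_. 1" 1 "\<lambda>j. 2 * j"]) (auto simp: inj_on_def)
  obtain W2 :: "'a \<Rightarrow>\<^sub>L 'a" where W2: "W2 \<in> carrier BH"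
    "\<And>x j. cinner (blinfun_apply W2 x) (e j) = 1 * cinner x (e (2 * j + 1))"
    by (rule weighted_coordinate_operator[of "\<lambda>_. 1" 1 "\<lambda>j. 2 * j + 1"]) (auto simp: inj_on_def)
  have WV: "blinfun_apply W1 (blinfun_apply V1 x) = x" "blinfun_apply W1 (blinfun_apply V2 x) = 0"
    "blinfun_apply W2 (blinfun_apply V1 x) = 0" "blinfun_apply W2 (blinfun_apply V2 x) = x" for x
    by (rule eqI, simp add: W1(2) W2(2) V1(2) V2(2))+
  define W where "W = (V1 o\<^sub>L S o\<^sub>L W1) + (V2 o\<^sub>L X o\<^sub>L W2)"
  have W: "W \<in> carrier BH"
    using S X V1(1) V2(1) W1(1) W2(1) by (simp add: W_def)
  have XS: "ideal (Idl\<^bsub>BH\<^esub> {X, S}) BH" "{X, S} \<subseteq> Idl\<^bsub>BH\<^esub> {X, S}"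
    using S X by (intro genideal_ideal genideal_self; simp)+
  have Wid: "ideal (Idl\<^bsub>BH\<^esub> {W}) BH" "W \<in> Idl\<^bsub>BH\<^esub> {W}"
    using W by (auto intro!: genideal_ideal genideal_self')
  have "W \<in> Idl\<^bsub>BH\<^esub> {X, S}"
    unfolding W_def using XS
    by (intro ideal_BH_add[OF XS(1)] ideal_BH_right[OF XS(1)] ideal_BH_left[OF XS(1)] V1(1) V2(1) W1(1) W2(1)) auto
  then have "Idl\<^bsub>BH\<^esub> {W} \<subseteq> Idl\<^bsub>BH\<^esub> {X, S}"
    by (intro genideal_minimal XS) auto
  moreover have "W1 o\<^sub>L W o\<^sub>L V1 = S" "W2 o\<^sub>L W o\<^sub>L V2 = X"
    by (rule blinfun_eqI, simp add: W_def blinfun.add_left blinfun.add_right WV)+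
  then have "S \<in> Idl\<^bsub>BH\<^esub> {W}" "X \<in> Idl\<^bsub>BH\<^esub> {W}"
    using Wid V1(1) V2(1) W1(1) W2(1) by (metis ideal_BH_left ideal_BH_right)+
  then have "Idl\<^bsub>BH\<^esub> {X, S} \<subseteq> Idl\<^bsub>BH\<^esub> {W}"
    by (intro genideal_minimal Wid) auto
  ultimately show thesis
    using that W by blast
qed

lemma upper_dense_countably_generated:
  "upper_dense_in (countably_generated_nonzero_ideals :: ('a \<Rightarrow>\<^sub>L 'a) set set) nonzero_ideals"
  unfolding upper_dense_in_def
proof (intro ballI impI)
  fix I J :: "('a \<Rightarrow>\<^sub>L 'a) set"
  assume I: "I \<in> countably_generated_nonzero_ideals" and J: "J \<in> nonzero_ideals" "I \<subset> J"
  then obtain S where S: "I \<in> nonzero_ideals" "I = Idl\<^bsub>BH\<^esub> S" "countable S" "S \<subseteq> carrier BH"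
    by (auto simp: countably_generated_nonzero_ideals_def)
  obtain X where X: "X \<in> carrier BH" "Idl\<^bsub>BH\<^esub> (insert X S) \<in> nonzero_ideals"
    "I \<subset> Idl\<^bsub>BH\<^esub> (insert X S)" "Idl\<^bsub>BH\<^esub> (insert X S) \<subset> J"
    by (rule intermediate_genideal[OF S J])
  moreover have "Idl\<^bsub>BH\<^esub> (insert X S) \<in> countably_generated_nonzero_ideals"
    unfolding countably_generated_nonzero_ideals_def mem_Collect_eq
    using X(1,2) S(3,4) by (intro conjI exI[of _ "insert X S"]) auto
  ultimately show "\<exists>L\<in>countably_generated_nonzero_ideals. I \<subset> L \<and> L \<subset> J"
    by blast
qed

lemma upper_dense_principal:
  "upper_dense_in (principal_nonzero_ideals :: ('a \<Rightarrow>\<^sub>L 'a) set set) nonzero_ideals"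
  unfolding upper_dense_in_def
proof (intro ballI impI)
  fix I J :: "('a \<Rightarrow>\<^sub>L 'a) set"
  assume I: "I \<in> principal_nonzero_ideals" and J: "J \<in> nonzero_ideals" "I \<subset> J"
  then obtain S where S: "I \<in> nonzero_ideals" "I = Idl\<^bsub>BH\<^esub> {S}" "S \<in> carrier BH"
    unfolding principal_nonzero_ideals_def using principalideal.generate by blast
  obtain X where X: "X \<in> carrier BH" "Idl\<^bsub>BH\<^esub> {X, S} \<in> nonzero_ideals"
    "I \<subset> Idl\<^bsub>BH\<^esub> {X, S}" "Idl\<^bsub>BH\<^esub> {X, S} \<subset> J"
    by (rule intermediate_genideal[OF S(1,2) _ _ J]) (use S(3) in auto)
  obtain W where W: "W \<in> carrier BH" "Idl\<^bsub>BH\<^esub> {X, S} = Idl\<^bsub>BH\<^esub> {W}"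
    by (rule genideal_pair_principal[OF S(3) X(1)])
  have "ideal (Idl\<^bsub>BH\<^esub> {X, S}) BH"
    using X(2) by (simp add: nonzero_ideals_def)
  then have "principalideal (Idl\<^bsub>BH\<^esub> {X, S}) BH"
    using W by (intro principalidealI) auto
  then have "Idl\<^bsub>BH\<^esub> {X, S} \<in> principal_nonzero_ideals"
    using X(2) by (simp add: principal_nonzero_ideals_def)
  with X(3,4) show "\<exists>L\<in>principal_nonzero_ideals. I \<subset> L \<and> L \<subset> J"
    by blast
qed

end

section \<open>Existence of an orthonormal basis\<close>

definition orthonormal_set :: "'a::complex_hilbert_space set \<Rightarrow> bool" where
  "orthonormal_set B \<longleftrightarrow> (\<forall>b\<in>B. \<forall>c\<in>B. cinner b c = (if b = c then 1 else 0))"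

text \<open>Zorn's lemma gives a maximal set; a nonzero vector orthogonal to all of it could be
  normalized and added.\<close>

lemma maximal_orthonormal_set:
  obtains B :: "'a::complex_hilbert_space set"
  where "orthonormal_set B" "\<And>x. (\<And>b. b \<in> B \<Longrightarrow> cinner x b = 0) \<Longrightarrow> x = 0"
proof -
  have "\<exists>M\<in>{B :: 'a set. orthonormal_set B}. \<forall>X\<in>{B. orthonormal_set B}. M \<subseteq> X \<longrightarrow> X = M"
  proof (rule subset_Zorn_nonempty)
    have "orthonormal_set {}" by (simp add: orthonormal_set_def)
    then show "{B :: 'a set. orthonormal_set B} \<noteq> {}" by blast
    show "\<Union>\<C> \<in> {B. orthonormal_set B}" if "\<C> \<noteq> {}" and ch: "subset.chain {B. orthonormal_set B} \<C>" for \<C> :: "'a set set"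
      unfolding mem_Collect_eq orthonormal_set_def
    proof (intro ballI)
      fix b c assume "b \<in> \<Union>\<C>" "c \<in> \<Union>\<C>"
      then obtain X Y where XY: "X \<in> \<C>" "Y \<in> \<C>" "b \<in> X" "c \<in> Y" by blast
      then have "X \<subseteq> Y \<or> Y \<subseteq> X" "orthonormal_set X" "orthonormal_set Y"
        using ch unfolding subset.chain_def by auto
      with XY show "cinner b c = (if b = c then 1 else 0)"
        unfolding orthonormal_set_def by (meson subsetD)
    qed
  qed
  then obtain B :: "'a set" where B: "orthonormal_set B" "\<And>X. orthonormal_set X \<Longrightarrow> B \<subseteq> X \<Longrightarrow> X = B"
    by auto
  have "x = 0" if x: "\<And>b. b \<in> B \<Longrightarrow> cinner x b = 0" for x
  proof (rule ccontr)
    assume "x \<noteq> 0"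
    define y where "y = complex_of_real (1 / norm x) *\<^sub>C x"
    have y1: "cinner y y = 1"
      using \<open>x \<noteq> 0\<close> by (simp add: cinner_self) (simp add: y_def norm_divide)
    have yb: "cinner y b = 0" if "b \<in> B" for b
      by (simp add: y_def cinner_scaleC_left x that)
    have by': "cinner b y = 0" if "b \<in> B" for b
      by (subst cinner_commute) (simp add: yb that)
    have "orthonormal_set (insert y B)"
      using B(1) y1 yb by' unfolding orthonormal_set_def by auto
    then have "y \<in> B"
      using B(2)[of "insert y B"] by auto
    with yb y1 show False by fastforce
  qed
  with B(1) that show thesis by blast
qed

text \<open>Distinct members have squared distance 2, so assigning to each a point of a countable
  dense set within distance 1/2 is injective.\<close>

lemma orthonormal_set_countable:
  fixes B :: "'a::complex_hilbert_space set"
  assumes sep: "separable_space (euclidean :: 'a topology)" and B: "orthonormal_set B"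
  shows "countable B"
proof -
  obtain D :: "'a set" where D: "countable D" "closure D = UNIV"
    using sep by (auto simp: separable_space_def)
  have "\<exists>d\<in>D. dist d b < 1/2" for b
    using D(2) closure_approachable[of b D] half_gt_zero[OF zero_less_one] by blast
  then obtain f where f: "\<And>b. f b \<in> D" "\<And>b. dist (f b) b < 1/2"
    by metis
  have "inj_on f B"
  proof (rule inj_onI, rule ccontr)
    fix b c assume bc: "b \<in> B" "c \<in> B" "f b = f c" "b \<noteq> c"
    have "dist b c < 1"
      using f(2)[of b] f(2)[of c] bc(3) dist_triangle2[of b c "f b"] by (simp add: dist_commute)
    then have "(norm (b - c))\<^sup>2 < 1"
      by (simp add: dist_norm power_less_one_iff abs_square_less_1)
    moreover have "(norm (b - c))\<^sup>2 = 2"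
    proof -
      have "inner b b = 1" "inner c c = 1" "inner b c = 0" "inner c b = 0"
        using B bc by (simp_all add: orthonormal_set_def flip: Re_cinner)
      then show ?thesis
        by (simp add: power2_norm_eq_inner inner_diff)
    qed
    ultimately show False by simp
  qed
  moreover have "countable (f ` B)"
    by (rule countable_subset[OF _ D(1)]) (use f(1) in auto)
  ultimately show ?thesis
    by (metis countable_image_inj_on)
qed

lemma orthonormal_basis_exists:
  assumes sep: "separable_space (euclidean :: 'a::complex_hilbert_space topology)"
    and inf: "infinite_dimensional TYPE('a)"
  obtains e :: "nat \<Rightarrow> 'a::complex_hilbert_space" where "orthonormal_basis e"
proof -
  obtain B :: "'a set" where B: "orthonormal_set B" "\<And>x. (\<And>b. b \<in> B \<Longrightarrow> cinner x b = 0) \<Longrightarrow> x = 0"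
    by (rule maximal_orthonormal_set) blast
  \<comment> \<open>If \<open>B\<close> were finite, subtracting from \<open>x\<close> its expansion
    along \<open>B\<close> would leave a vector orthogonal to \<open>B\<close>, hence 0; then
    \<open>B\<close> would span the space.\<close>
  have "infinite B"
  proof
    assume fin: "finite B"
    have "x \<in> scaleC.span B" for x
    proof -
      define y where "y = (\<Sum>b\<in>B. cinner x b *\<^sub>C b)"
      have "cinner y c = cinner x c" if "c \<in> B" for c
      proof -
        have "cinner y c = (\<Sum>b\<in>B. if b = c then cinner x c else 0)"
          unfolding y_def cinner_sum_left using B(1) that
          by (intro sum.cong) (auto simp: cinner_scaleC_left orthonormal_set_def)
        then show ?thesis
          using fin that by simp
      qed
      then have "x = y"
        using B(2)[of "x - y"] by (simp add: cinner_diff_left)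
      moreover have "y \<in> scaleC.span B"
        unfolding y_def by (intro scaleC.span_sum scaleC.span_scale scaleC.span_base)
      ultimately show ?thesis
        by simp
    qed
    then have "scaleC.span B = UNIV"
      by (simp add: set_eq_iff)
    with inf fin show False
      unfolding infinite_dimensional_def by simp
  qed
  then have bij: "bij_betw (from_nat_into B) UNIV B"
    by (intro bij_betw_from_nat_into orthonormal_set_countable[OF sep B(1)])
  have "orthonormal_basis (from_nat_into B)"
  proof
    fix i j
    have "from_nat_into B i \<in> B" "from_nat_into B j \<in> B" "from_nat_into B i = from_nat_into B j \<longleftrightarrow> i = j"
      using bij by (auto simp: bij_betw_def dest: injD)
    then show "cinner (from_nat_into B i) (from_nat_into B j) = (if i = j then 1 else 0)"
      using B(1) unfolding orthonormal_set_def by simp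
  next
    show "x = 0" if "\<And>j. cinner x (from_nat_into B j) = 0" for x
      using B(2)[of x] that bij by (metis bij_betw_imp_surj_on rangeE)
  qed
  then show thesis by (rule that)
qed

theorem corollary3p7:
  assumes "separable_space (euclidean :: 'a::complex_hilbert_space topology)"
    and "infinite_dimensional TYPE('a)"
  shows "upper_dense_in (countably_generated_nonzero_ideals :: ('a \<Rightarrow>\<^sub>L 'a) set set) nonzero_ideals
       \<and> upper_dense_in (principal_nonzero_ideals :: ('a \<Rightarrow>\<^sub>L 'a) set set) nonzero_ideals
       \<and> (\<nexists>I J. is_gap (countably_generated_nonzero_ideals :: ('a \<Rightarrow>\<^sub>L 'a) set set) I J)
       \<and> (\<nexists>I J. is_gap (principal_nonzero_ideals :: ('a \<Rightarrow>\<^sub>L 'a) set set) I J)"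
proof -
  obtain e :: "nat \<Rightarrow> 'a" where "orthonormal_basis e"
    using orthonormal_basis_exists[OF assms] .
  then interpret orthonormal_basis e .
  \<comment> \<open>The upper member of a gap in \<open>M\<close> is itself a nonzero ideal, so
    upper density in \<open>nonzero_ideals\<close> already places a member of \<open>M\<close>
    strictly between.\<close>
  have no_gap: "\<nexists>I J. is_gap M I J" if M: "upper_dense_in M nonzero_ideals" "M \<subseteq> nonzero_ideals"
    for M :: "('a \<Rightarrow>\<^sub>L 'a) set set"
  proof (intro notI, elim exE)
    fix I J assume "is_gap M I J"
    then have *: "I \<in> M" "J \<in> M" "I \<subset> J" and gap: "\<not> (\<exists>L\<in>M. I \<subset> L \<and> L \<subset> J)"
      by (simp_all add: is_gap_def)
    have "\<exists>L\<in>M. I \<subset> L \<and> L \<subset> J"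
      using M(1)[unfolded upper_dense_in_def, rule_format, OF *(1) subsetD[OF M(2) *(2)] *(3)] .
    with gap show False by contradiction
  qed
  have "countably_generated_nonzero_ideals \<subseteq> (nonzero_ideals :: ('a \<Rightarrow>\<^sub>L 'a) set set)"
    by (simp add: countably_generated_nonzero_ideals_def)
  moreover have "principal_nonzero_ideals \<subseteq> (nonzero_ideals :: ('a \<Rightarrow>\<^sub>L 'a) set set)"
    by (simp add: principal_nonzero_ideals_def)
  ultimately show ?thesis
    by (intro conjI no_gap upper_dense_countably_generated upper_dense_principal)
qed

end
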